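(* Let $H=(Q^0,Q^1,\delta^0,\delta^1,q_0)$ be a two-player game graph, $Q=Q^0\cup Q^1$, $\mathcal F_{\mathcal A}=\{F_{\mathcal A}^1,\dots,F_{\mathcal A}^m\}$ and $\mathcal F_{\mathcal G}=\{F_{\mathcal G}^1,\dots,F_{\mathcal G}^n\}$ families of subsets of $Q$. Let $[\![\varphi_4^v]\!]=\bigcup_{a\in[1;n]}{}^aZ^\infty$ and the ranks ${}^{ab}\mathrm{rank}$ be as defined below, and let $f^1$ be a mode-based system strategy as defined below. Then for all $q\in[\![\varphi_4^v]\!]$: (a) $\mathcal L_q(H,f^1)\subseteq\overline{\mathcal L_q(H,\mathcal F_{\mathcal A})}\cup\mathcal L_q(H,\mathcal F_{\mathcal G})$; (b) $\mathcal L_q(H,f^1)\cap\mathcal L_q(H,\mathcal F_{\mathcal G})\neq\emptyset$; (c) if $\mathcal L_q(H,\mathcal F_{\mathcal G})\subseteq\mathcal L_q(H,\mathcal F_{\mathcal A})$ then $\mathrm{pre}(\mathcal L_q(H,f^1))=\mathrm{pre}(\mathcal L_q(H,f^1)\cap\mathcal L_q(H,\mathcal F_{\mathcal A}))$. Furthermore, for every $q\in Q\setminus[\![\varphi_4^v]\!]$ and every system strategy $g$ over $H$, at least one of the following fails: (i) $\emptyset\neq\mathcal L_q(H,g)\subseteq\overline{\mathcal L_q(H,\mathcal F_{\mathcal A})}\cup\mathcal L_q(H,\mathcal F_{\mathcal G})$; (ii) $\mathrm{pre}(\mathcal L_q(H,g))=\mathrm{pre}(\mathcal L_q(H,g)\cap\mathcal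 L_q(H,\mathcal F_{\mathcal A}))$.
   Context: Game graph $H$: finite disjoint $Q^0$ (environment) and $Q^1$ (system), $\delta^0:Q^0\to2^{Q^1}$, $\delta^1:Q^1\to2^{Q^0}$, $q_0\in Q^0$. A play from $q$ is an infinite state sequence starting at $q$ following $\delta^0$ at $Q^0$-states and $\delta^1$ at $Q^1$-states. An (ordinary) system strategy maps finite play prefixes ending in $Q^1$ to $Q^0$; $\mathcal L_q(H,g)$ is the set of plays from $q$ whose system moves follow $g$. $\mathcal L_q(H,\mathcal F)$: plays from $q$ visiting every set of $\mathcal F$ infinitely often; $\overline{\mathcal L}$: complement among infinite sequences; $\mathrm{pre}(\mathcal L)$: set of finite prefixes of words of $\mathcal L$. Operators for $P,P'\subseteq Q$: $\mathrm{Pre}^{\exists}(P)=\{q\in Q^0:\delta^0(q)\cap P\ne\emptyset\}\cup\{q\in Q^1:\delta^1(q)\cap P\ne\emptyset\}$, $\mathrm{Pre}^1(P)=\{q\in Q^0:\delta^0(q)\subseteq P\}\cup\{q\in Q^1:\delta^1(q)\cap P\ne\emptyset\}$, $\mathrm{CPre}(P,P')=\mathrm{Pre}^{\exists}(P)\cap\mathrm{Pre}^1(P\cup P')$. For $a\in[1;n]$ let $a^+=(a\bmod n)+1$. Define ${}^{ab}\Omega(Z,Y,X,W)=(F_{\mathcal G}^a\cap\mathrm{Pre}^1(Z))\cup\mathrm{Pre}^1(Y)\cup((Q\setminus F^b_{\mathcal A})\cap\mathrm{CPre}(W,X\setminus F^b_{\mathcal A}))$. $\varphi_4^v$ is the vector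 greatest fixpoint $\nu({}^1Z,\dots,{}^nZ)$ where the $a$-th component is ${}^aZ=\mu\,{}^aY.\bigcup_{b=1}^m\nu\,{}^{ab}X.\mu\,{}^{ab}W.\,{}^{ab}\Omega({}^{a^+}Z,{}^aY,{}^{ab}X,{}^{ab}W)$; its value is $({}^1Z^\infty,\dots,{}^nZ^\infty)$. Ranking: for each $a$, with ${}^{a^+}Z:={}^{a^+}Z^\infty$, let ${}^aY^0=\emptyset$; for $i\ge1$, ${}^{ab}X^i=\nu X.\mu W.{}^{ab}\Omega({}^{a^+}Z^\infty,{}^aY^{i-1},X,W)$ and ${}^aY^i=\bigcup_b{}^{ab}X^i$; ${}^{ab}W^i_0=\emptyset$, ${}^{ab}W^i_j={}^{ab}\Omega({}^{a^+}Z^\infty,{}^aY^{i-1},{}^{ab}X^i,{}^{ab}W^i_{j-1})$. For $i,j>0$, ${}^{ab}\mathrm{rank}(q)=(i,j)$ iff $q\in({}^aY^i\setminus{}^aY^{i-1})\cap({}^{ab}W^i_j\setminus{}^{ab}W^i_{j-1})$ (undefined otherwise). Ranks are ordered lexicographically; ${}^{a'b'}\mathrm{rank}(q')\le(i-1,\cdot)$ means it is defined with first component at most $i-1$. Mode-based strategy: $f^1:\bigcup_{a\in[1;n]}((Q^1\cap{}^aZ^\infty)\times\{a\}\times[1;m])\to Q^0\times[1;n]\times[1;m]$ such that $(q',a',b')=f^1(q,a,b)$ implies $q'\in\delta^1(q)$ and: if ${}^{ab}\mathrm{rank}(q)=(1,1)$ then $q'\in{}^{a^+}Z^\infty$ and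 $a'=a^+$; if ${}^{ab}\mathrm{rank}(q)=(i,1)$, $i>1$, then ${}^{a'b'}\mathrm{rank}(q')\le(i-1,\cdot)$ and $a'=a$; if ${}^{ab}\mathrm{rank}(q)=(i,j)$, $j>1$, then ${}^{a'b'}\mathrm{rank}(q')\le(i,j-1)$, $a'=a$, $b'=b$. $\mathcal L_q(H,f^1)$ is the set of plays $\pi$ from $q$ for which there exist mode sequences $\alpha\in[1;n]^\omega$, $\beta\in[1;m]^\omega$ such that for all $k$: if $\pi(k)\in Q^1$ then $(\pi(k+1),\alpha(k+1),\beta(k+1))=f^1(\pi(k),\alpha(k),\beta(k))$; if $\pi(k)\in Q^0$, with $a=\alpha(k)$, $b=\beta(k)$: $\alpha(k+1)=a^+$ if ${}^{ab}\mathrm{rank}(\pi(k))=(1,1)$; $\alpha(k+1)=a$ if ${}^{ab}\mathrm{rank}(\pi(k))=(i,1)$, $i>1$; $\alpha(k+1)=a$ and $\beta(k+1)=b$ if ${}^{ab}\mathrm{rank}(\pi(k))=(i,j)$, $j>1$.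
   Formalization: In L_q(H,f¹) modes must have a defined rank at each state, and a prescribed b' with undefined rank is replaced by one with defined rank (else (a) fails); environment states must have successors (else (b) fails); system strategies must move legally on all finite plays; m,n ≥ 1. *)

theory Defs
  imports Main
begin

record 'q game =
  env :: "'q set"
  sys :: "'q set"
  env_trans :: "'q \<Rightarrow> 'q set"
  sys_trans :: "'q \<Rightarrow> 'q set"
  init :: 'q

definition states :: "'q game \<Rightarrow> 'q set" where
  "states H = env H \<union> sys H"

definition game_graph :: "'q game \<Rightarrow> bool" where
  "game_graph H \<longleftrightarrow>
     finite (env H) \<and> finite (sys H) \<and> env H \<inter> sys H = {} \<and>
     (\<forall>q\<in>env H. env_trans H q \<subseteq> sys H) \<and>
     (\<forall>q\<in>sys H. sys_trans H q \<subseteq> env H) \<and>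
     init H \<in> env H"

definition edge :: "'q game \<Rightarrow> 'q \<Rightarrow> 'q \<Rightarrow> bool" where
  "edge H p p' \<longleftrightarrow>
     p \<in> env H \<and> p' \<in> env_trans H p \<or> p \<in> sys H \<and> p' \<in> sys_trans H p"

definition plays :: "'q game \<Rightarrow> 'q \<Rightarrow> (nat \<Rightarrow> 'q) set" where
  "plays H q = {\<pi>. \<pi> 0 = q \<and> (\<forall>k. edge H (\<pi> k) (\<pi> (Suc k)))}"

definition prefix :: "nat \<Rightarrow> (nat \<Rightarrow> 'q) \<Rightarrow> 'q list" where
  "prefix k \<pi> = map \<pi> [0..<k]"

definition pre :: "(nat \<Rightarrow> 'q) set \<Rightarrow> 'q list set" where
  "pre L = {prefix k \<pi> | k \<pi>. \<pi> \<in> L}"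

text \<open>A family of \<open>N\<close> sets is a function of which only the values at \<open>1, \<dots>, N\<close> matter.\<close>

definition buechi_plays :: "'q game \<Rightarrow> 'q \<Rightarrow> nat \<Rightarrow> (nat \<Rightarrow> 'q set) \<Rightarrow> (nat \<Rightarrow> 'q) set" where
  "buechi_plays H q N F = {\<pi> \<in> plays H q. \<forall>c\<in>{1..N}. \<exists>\<^sub>\<infinity>k. \<pi> k \<in> F c}"

definition compl_lang :: "'q game \<Rightarrow> (nat \<Rightarrow> 'q) set \<Rightarrow> (nat \<Rightarrow> 'q) set" where
  "compl_lang H L = {\<pi>. \<forall>k. \<pi> k \<in> states H} - L"

text \<open>
  Finite plays may end in a dead end. Since a strategy must have a legal move on every finite
  play that ends in a system state, there is none if \<open>H\<close> has a system dead end.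
\<close>

definition finite_plays :: "'q game \<Rightarrow> 'q list set" where
  "finite_plays H =
     {\<nu>. \<nu> \<noteq> [] \<and> set \<nu> \<subseteq> states H \<and>
         (\<forall>k. Suc k < length \<nu> \<longrightarrow> edge H (\<nu> ! k) (\<nu> ! Suc k))}"

definition system_strategy :: "'q game \<Rightarrow> ('q list \<Rightarrow> 'q) \<Rightarrow> bool" where
  "system_strategy H g \<longleftrightarrow>
     (\<forall>\<nu>\<in>finite_plays H. last \<nu> \<in> sys H \<longrightarrow> g \<nu> \<in> sys_trans H (last \<nu>))"

definition strategy_plays :: "'q game \<Rightarrow> 'q \<Rightarrow> ('q list \<Rightarrow> 'q) \<Rightarrow> (nat \<Rightarrow> 'q) set" where
  "strategy_plays H q g =
     {\<pi> \<in> plays H q. \<forall>k. \<pi> k \<in> sys H \<longrightarrow> \<pi> (Suc k) = g (prefix (Suc k) \<pi>)}"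

definition PreE :: "'q game \<Rightarrow> 'q set \<Rightarrow> 'q set" where
  "PreE H P = {q \<in> env H. env_trans H q \<inter> P \<noteq> {}} \<union> {q \<in> sys H. sys_trans H q \<inter> P \<noteq> {}}"

definition Pre1 :: "'q game \<Rightarrow> 'q set \<Rightarrow> 'q set" where
  "Pre1 H P = {q \<in> env H. env_trans H q \<subseteq> P} \<union> {q \<in> sys H. sys_trans H q \<inter> P \<noteq> {}}"

definition CPre :: "'q game \<Rightarrow> 'q set \<Rightarrow> 'q set \<Rightarrow> 'q set" where
  "CPre H P P' = PreE H P \<inter> Pre1 H (P \<union> P')"

definition nxt :: "nat \<Rightarrow> nat \<Rightarrow> nat" where
  "nxt n a = a mod n + 1"

definition Om ::
  "'q game \<Rightarrow> (nat \<Rightarrow> 'q set) \<Rightarrow> (nat \<Rightarrow> 'q set) \<Rightarrow> nat \<Rightarrow> nat \<Rightarrow>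
   'q set \<Rightarrow> 'q set \<Rightarrow> 'q set \<Rightarrow> 'q set \<Rightarrow> 'q set" where
  "Om H FA FG a b Z Y X W =
     (FG a \<inter> Pre1 H Z) \<union> Pre1 H Y \<union> ((states H - FA b) \<inter> CPre H W (X - FA b))"

text \<open>The vector is a function of the index, kept empty outside \<open>{1..n}\<close>.\<close>

definition Zinf ::
  "'q game \<Rightarrow> nat \<Rightarrow> nat \<Rightarrow> (nat \<Rightarrow> 'q set) \<Rightarrow> (nat \<Rightarrow> 'q set) \<Rightarrow> nat \<Rightarrow> 'q set" where
  "Zinf H m n FA FG =
     gfp (\<lambda>Z a. if a \<in> {1..n}
       then lfp (\<lambda>Y. \<Union>b\<in>{1..m}. gfp (\<lambda>X. lfp (\<lambda>W. Om H FA FG a b (Z (nxt n a)) Y X W)))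
       else {})"

definition phi4 ::
  "'q game \<Rightarrow> nat \<Rightarrow> nat \<Rightarrow> (nat \<Rightarrow> 'q set) \<Rightarrow> (nat \<Rightarrow> 'q set) \<Rightarrow> 'q set" where
  "phi4 H m n FA FG = (\<Union>a\<in>{1..n}. Zinf H m n FA FG a)"

text \<open>\<open>Xset\<close> takes the set \<open>Y\<close> of the previous level as its last argument.\<close>

definition Xset ::
  "'q game \<Rightarrow> nat \<Rightarrow> nat \<Rightarrow> (nat \<Rightarrow> 'q set) \<Rightarrow> (nat \<Rightarrow> 'q set) \<Rightarrow> nat \<Rightarrow> nat \<Rightarrow> 'q set \<Rightarrow> 'q set" where
  "Xset H m n FA FG a b Y =
     gfp (\<lambda>X. lfp (\<lambda>W. Om H FA FG a b (Zinf H m n FA FG (nxt n a)) Y X W))"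

primrec Yrank ::
  "'q game \<Rightarrow> nat \<Rightarrow> nat \<Rightarrow> (nat \<Rightarrow> 'q set) \<Rightarrow> (nat \<Rightarrow> 'q set) \<Rightarrow> nat \<Rightarrow> nat \<Rightarrow> 'q set" where
  "Yrank H m n FA FG a 0 = {}"
| "Yrank H m n FA FG a (Suc i) = (\<Union>b\<in>{1..m}. Xset H m n FA FG a b (Yrank H m n FA FG a i))"

primrec Wrank ::
  "'q game \<Rightarrow> nat \<Rightarrow> nat \<Rightarrow> (nat \<Rightarrow> 'q set) \<Rightarrow> (nat \<Rightarrow> 'q set) \<Rightarrow> nat \<Rightarrow> nat \<Rightarrow> nat \<Rightarrow> nat \<Rightarrow> 'q set" where
  "Wrank H m n FA FG a b i 0 = {}"
| "Wrank H m n FA FG a b i (Suc j) =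
     Om H FA FG a b (Zinf H m n FA FG (nxt n a)) (Yrank H m n FA FG a (i - 1))
       (Xset H m n FA FG a b (Yrank H m n FA FG a (i - 1))) (Wrank H m n FA FG a b i j)"

text \<open>The partial function \<open>rank\<close> is given by its graph.\<close>

definition rank_is ::
  "'q game \<Rightarrow> nat \<Rightarrow> nat \<Rightarrow> (nat \<Rightarrow> 'q set) \<Rightarrow> (nat \<Rightarrow> 'q set) \<Rightarrow> nat \<Rightarrow> nat \<Rightarrow> 'q \<Rightarrow>
   nat \<times> nat \<Rightarrow> bool" where
  "rank_is H m n FA FG a b q r \<longleftrightarrow>
     (case r of (i, j) \<Rightarrow> 0 < i \<and> 0 < j \<and>
        q \<in> Yrank H m n FA FG a i - Yrank H m n FA FG a (i - 1) \<and>
        q \<in> Wrank H m n FA FG a b i j - Wrank H m n FA FG a b i (j - 1))"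

definition ranked ::
  "'q game \<Rightarrow> nat \<Rightarrow> nat \<Rightarrow> (nat \<Rightarrow> 'q set) \<Rightarrow> (nat \<Rightarrow> 'q set) \<Rightarrow> nat \<Rightarrow> nat \<Rightarrow> 'q \<Rightarrow> bool" where
  "ranked H m n FA FG a b q \<longleftrightarrow> (\<exists>r. rank_is H m n FA FG a b q r)"

text \<open>
  A mode-based strategy is constrained only on
  \<open>\<Union>a\<in>{1..n}. (sys H \<inter> Zinf H m n FA FG a) \<times> {a} \<times> {1..m}\<close>, its domain.
\<close>

definition mode_strategy ::
  "'q game \<Rightarrow> nat \<Rightarrow> nat \<Rightarrow> (nat \<Rightarrow> 'q set) \<Rightarrow> (nat \<Rightarrow> 'q set) \<Rightarrow>
   ('q \<times> nat \<times> nat \<Rightarrow> 'q \<times> nat \<times> nat) \<Rightarrow> bool" where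
  "mode_strategy H m n FA FG f \<longleftrightarrow>
     (\<forall>a\<in>{1..n}. \<forall>q \<in> sys H \<inter> Zinf H m n FA FG a. \<forall>b\<in>{1..m}. \<forall>q' a' b'.
        (q', a', b') = f (q, a, b) \<longrightarrow>
          q' \<in> env H \<and> a' \<in> {1..n} \<and> b' \<in> {1..m} \<and>
          q' \<in> sys_trans H q \<and>
          (rank_is H m n FA FG a b q (1, 1) \<longrightarrow>
             q' \<in> Zinf H m n FA FG (nxt n a) \<and> a' = nxt n a) \<and>
          (\<forall>i>1. rank_is H m n FA FG a b q (i, 1) \<longrightarrow>
             (\<exists>i' j'. rank_is H m n FA FG a' b' q' (i', j') \<and> i' \<le> i - 1) \<and> a' = a) \<and>
          (\<forall>i. \<forall>j>1. rank_is H m n FA FG a b q (i, j) \<longrightarrow>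
             (\<exists>i' j'. rank_is H m n FA FG a' b' q' (i', j') \<and>
                (i' < i \<or> i' = i \<and> j' \<le> j - 1)) \<and>
             a' = a \<and> b' = b))"

text \<open>
  The modes \<open>(a', b')\<close> that the strategy, or at an environment state the rank, prescribes
  for the step from \<open>p\<close> to \<open>p'\<close> in mode \<open>(a, b)\<close>.
\<close>

definition mode_step ::
  "'q game \<Rightarrow> nat \<Rightarrow> nat \<Rightarrow> (nat \<Rightarrow> 'q set) \<Rightarrow> (nat \<Rightarrow> 'q set) \<Rightarrow>
   ('q \<times> nat \<times> nat \<Rightarrow> 'q \<times> nat \<times> nat) \<Rightarrow> 'q \<times> nat \<times> nat \<Rightarrow> 'q \<times> nat \<times> nat \<Rightarrow> bool" where
  "mode_step H m n FA FG f = (\<lambda>(p, a, b) (p', a', b').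
     (p \<in> sys H \<longrightarrow> (p', a', b') = f (p, a, b)) \<and>
     (p \<in> env H \<longrightarrow>
        (rank_is H m n FA FG a b p (1, 1) \<longrightarrow> a' = nxt n a) \<and>
        (\<forall>i>1. rank_is H m n FA FG a b p (i, 1) \<longrightarrow> a' = a) \<and>
        (\<forall>i. \<forall>j>1. rank_is H m n FA FG a b p (i, j) \<longrightarrow> a' = a \<and> b' = b)))"

text \<open>
  The rules in \<open>mode_step\<close> say nothing in a mode \<open>(a, b)\<close> whose rank is undefined at the
  current state, yet they can prescribe such a mode: a state of \<open>Zinf H m n FA FG a\<close> is
  ranked for some \<open>b\<close>, but not for every \<open>b\<close>. Without further conditions a play could
  therefore escape all control. Hence every mode along a play is required to be ranked, and
  a prescribed \<open>b'\<close> that is not ranked at the state reached is replaced by some mode that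
  is; a ranked \<open>b'\<close> is kept.
\<close>

definition mode_plays ::
  "'q game \<Rightarrow> nat \<Rightarrow> nat \<Rightarrow> (nat \<Rightarrow> 'q set) \<Rightarrow> (nat \<Rightarrow> 'q set) \<Rightarrow> 'q \<Rightarrow>
   ('q \<times> nat \<times> nat \<Rightarrow> 'q \<times> nat \<times> nat) \<Rightarrow> (nat \<Rightarrow> 'q) set" where
  "mode_plays H m n FA FG q f =
     {\<pi> \<in> plays H q. \<exists>\<alpha> \<beta>. \<forall>k.
        \<alpha> k \<in> {1..n} \<and> \<beta> k \<in> {1..m} \<and>
        ranked H m n FA FG (\<alpha> k) (\<beta> k) (\<pi> k) \<and>
        (\<exists>b'\<in>{1..m}.
           mode_step H m n FA FG f (\<pi> k, \<alpha> k, \<beta> k) (\<pi> (Suc k), \<alpha> (Suc k), b') \<and>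
           (ranked H m n FA FG (\<alpha> (Suc k)) b' (\<pi> (Suc k)) \<longrightarrow> \<beta> (Suc k) = b'))}"

end

(*
  Sufficiency. Along a play that follows the strategy, the first rank component never increases
  while the goal index a is unchanged. Either rank (1,1) occurs infinitely often, and then a runs
  through all goals and each of them is visited infinitely often, or eventually a, b and the first
  component are constant; then all ranks are (i,j) with j > 1 and F_A^b is never visited again.
  Since the environment always has a move that decreases the rank, every finite play extends to
  one of the first kind.

  Necessity. Let S be the set of states visited by plays consistent with a strategy g that
  satisfies (i) and (ii). The vector (S,...,S) is a post-fixpoint of the operator defining phi_4:
  if a history ended outside the a-th component T of its image, then by (ii) it could be
  extended, without visiting F_G^a, so as to visit F_A^b and leave T again, for b = 1,...,m in
  turn. Iterating this yields a play that contradicts (i).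
*)
theory Submission
  imports Defs "HOL-Library.Infinite_Set"
begin

lemma lfp_eq_Union_funpow:
  fixes f :: "'a set \<Rightarrow> 'a set"
  assumes "mono f" "finite A" "\<And>X. f X \<subseteq> A"
  shows "lfp f = (\<Union>i. (f ^^ i) {})"
proof
  let ?U = "\<Union>i. (f ^^ i) {}"
  have step: "(f ^^ i) {} \<subseteq> (f ^^ Suc i) {}" for i
  proof (induction i)
    case (Suc i)
    then show ?case using monoD[OF assms(1), OF Suc] by simp
  qed simp
  have inc: "(f ^^ i) {} \<subseteq> (f ^^ k) {}" if "i \<le> k" for i k
    using lift_Suc_mono_le[of "\<lambda>i. (f ^^ i) {}", OF step that] .
  have sub: "(f ^^ i) {} \<subseteq> A" for i
    by (cases i) (use assms(3) in auto)
  have fin: "finite ?U"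
    using assms(2) sub by (meson UN_least finite_subset)
  have "\<exists>N. B \<subseteq> (f ^^ N) {}" if "finite B" "B \<subseteq> ?U" for B
    using that
  proof (induction B rule: finite_induct)
    case (insert x B)
    then obtain N k where "B \<subseteq> (f ^^ N) {}" "x \<in> (f ^^ k) {}" by auto
    then have "insert x B \<subseteq> (f ^^ (max N k)) {}"
      using inc[of N "max N k"] inc[of k "max N k"] by auto
    then show ?case by blast
  qed auto
  then obtain N where "?U \<subseteq> (f ^^ N) {}" using fin by blast
  then have "f ?U \<subseteq> f ((f ^^ N) {})" by (rule monoD[OF assms(1)])
  then have "f ?U \<subseteq> (f ^^ Suc N) {}" by simp
  then have "f ?U \<subseteq> ?U" by blast
  then show "lfp f \<subseteq> ?U" by (rule lfp_lowerbound)
next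
  have "(f ^^ i) {} \<subseteq> lfp f" for i
  proof (induction i)
    case (Suc i)
    then have "f ((f ^^ i) {}) \<subseteq> f (lfp f)" by (rule monoD[OF assms(1)])
    then show ?case using lfp_unfold[OF assms(1)] by auto
  qed auto
  then show "(\<Union>i. (f ^^ i) {}) \<subseteq> lfp f" by blast
qed

lemma Pre1_mono: "P \<subseteq> P' \<Longrightarrow> Pre1 H P \<subseteq> Pre1 H P'"
  unfolding Pre1_def by blast

lemma PreE_mono: "P \<subseteq> P' \<Longrightarrow> PreE H P \<subseteq> PreE H P'"
  unfolding PreE_def by blast

lemma CPre_mono: "P \<subseteq> P' \<Longrightarrow> R \<subseteq> R' \<Longrightarrow> CPre H P R \<subseteq> CPre H P' R'"
  unfolding CPre_def by (intro Int_mono PreE_mono Pre1_mono Un_mono)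

lemma Om_mono:
  "Z \<subseteq> Z' \<Longrightarrow> Y \<subseteq> Y' \<Longrightarrow> X \<subseteq> X' \<Longrightarrow> W \<subseteq> W' \<Longrightarrow>
    Om H FA FG a b Z Y X W \<subseteq> Om H FA FG a b Z' Y' X' W'"
  unfolding Om_def by (intro Un_mono Int_mono Pre1_mono CPre_mono Diff_mono order_refl)

lemma Om_subset_states: "Om H FA FG a b Z Y X W \<subseteq> states H"
  unfolding Om_def Pre1_def states_def by blast

lemma mono_Om: "mono (Om H FA FG a b Z Y X)"
  by (intro monoI Om_mono) auto

lemma lfp_Om_mono:
  "Z \<subseteq> Z' \<Longrightarrow> Y \<subseteq> Y' \<Longrightarrow> X \<subseteq> X' \<Longrightarrow>
    lfp (Om H FA FG a b Z Y X) \<subseteq> lfp (Om H FA FG a b Z' Y' X')"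
  by (intro lfp_mono Om_mono) auto

lemma mono_lfp_Om: "mono (\<lambda>X. lfp (Om H FA FG a b Z Y X))"
  by (intro monoI lfp_Om_mono) auto

lemma gfp_Om_mono:
  "Z \<subseteq> Z' \<Longrightarrow> Y \<subseteq> Y' \<Longrightarrow>
    gfp (\<lambda>X. lfp (Om H FA FG a b Z Y X)) \<subseteq> gfp (\<lambda>X. lfp (Om H FA FG a b Z' Y' X))"
  by (intro gfp_mono lfp_Om_mono) auto

lemma mono_gfp_Om: "mono (\<lambda>Y. \<Union>b\<in>B. gfp (\<lambda>X. lfp (Om H FA FG a b Z Y X)))"
proof (rule monoI)
  fix Y Y' :: "'a set"
  assume "Y \<subseteq> Y'"
  then show "(\<Union>b\<in>B. gfp (\<lambda>X. lfp (Om H FA FG a b Z Y X)))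
      \<subseteq> (\<Union>b\<in>B. gfp (\<lambda>X. lfp (Om H FA FG a b Z Y' X)))"
    by (intro UN_mono gfp_Om_mono) auto
qed

lemma lfp_gfp_Om_mono:
  "Z \<subseteq> Z' \<Longrightarrow> lfp (\<lambda>Y. \<Union>b\<in>B. gfp (\<lambda>X. lfp (Om H FA FG a b Z Y X)))
    \<subseteq> lfp (\<lambda>Y. \<Union>b\<in>B. gfp (\<lambda>X. lfp (Om H FA FG a b Z' Y X)))"
  by (intro lfp_mono UN_mono gfp_Om_mono) auto

lemma Zinf_unfold:
  assumes "a \<in> {1..n}"
  shows "Zinf H m n FA FG a = lfp (\<lambda>Y. \<Union>b\<in>{1..m}. Xset H m n FA FG a b Y)"
proof -
  define \<Phi> where "\<Phi> = (\<lambda>Z a. if a \<in> {1..n}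
    then lfp (\<lambda>Y. \<Union>b\<in>{1..m}. gfp (\<lambda>X. lfp (Om H FA FG a b (Z (nxt n a)) Y X))) else {})"
  have "\<Phi> Z \<le> \<Phi> Z'" if "Z \<le> Z'" for Z Z'
    unfolding \<Phi>_def le_fun_def using le_funD[OF that] by (simp add: lfp_gfp_Om_mono)
  then have "mono \<Phi>" by (rule monoI)
  then have "gfp \<Phi> = \<Phi> (gfp \<Phi>)" by (rule gfp_unfold)
  moreover have "Zinf H m n FA FG = gfp \<Phi>"
    unfolding Zinf_def \<Phi>_def by simp
  ultimately have "Zinf H m n FA FG a = \<Phi> (Zinf H m n FA FG) a" by simp
  also have "\<dots> = lfp (\<lambda>Y. \<Union>b\<in>{1..m}. Xset H m n FA FG a b Y)"
    unfolding \<Phi>_def Xset_def by (simp only: assms if_True)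
  finally show ?thesis .
qed

lemma nxt_in_range: "1 \<le> n \<Longrightarrow> nxt n a \<in> {1..n}"
  unfolding nxt_def by (simp add: Suc_le_eq)
lemma nxt_closed_imp_all:
  assumes "a \<in> A" "A \<subseteq> {1..n}" "\<And>x. x \<in> A \<Longrightarrow> nxt n x \<in> A" "c \<in> {1..n}"
  shows "c \<in> A"
proof -
  have up: "e \<le> d \<Longrightarrow> d \<le> n \<Longrightarrow> e \<in> A \<Longrightarrow> d \<in> A" for d e
  proof (induction d rule: dec_induct)
    case (step d)
    then have "d \<in> A" by simp
    then have "nxt n d \<in> A" by (rule assms(3))
    moreover have "nxt n d = Suc d" using step by (simp add: nxt_def)
    ultimately show ?case by simp
  qed
  have "n \<in> A" using up[of a n] assms(1,2) by auto
  then have "nxt n n \<in> A" by (rule assms(3))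
  then have "1 \<in> A" by (simp add: nxt_def)
  then show ?thesis using up[of 1 c] assms(4) by auto
qed

locale gr1_game =
  fixes H :: "'q game" and m n :: nat and FA FG :: "nat \<Rightarrow> 'q set"
  assumes graph: "game_graph H"
    and env_live: "\<And>q. q \<in> env H \<Longrightarrow> env_trans H q \<noteq> {}"
    and m_pos: "1 \<le> m" and n_pos: "1 \<le> n"
begin

lemma finite_states: "finite (states H)"
  using graph unfolding game_graph_def states_def by simp

lemma env_sys_disjoint: "q \<in> env H \<Longrightarrow> q \<notin> sys H"
  using graph unfolding game_graph_def by blast

lemma edge_states: "edge H p p' \<Longrightarrow> p \<in> states H \<and> p' \<in> states H"
  using graph unfolding edge_def game_graph_def states_def by blast

lemma plays_states: "\<pi> \<in> plays H q \<Longrightarrow> \<pi> k \<in> states H"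
  unfolding plays_def using edge_states by blast

lemma compl_langI: "\<pi> \<in> plays H q \<Longrightarrow> \<pi> \<notin> L \<Longrightarrow> \<pi> \<in> compl_lang H L"
  unfolding compl_lang_def using plays_states by blast

end

subsection \<open>Ranks and mode-based strategies\<close>

context gr1_game
begin

abbreviation Zi :: "nat \<Rightarrow> 'q set" where "Zi \<equiv> Zinf H m n FA FG"
abbreviation Yr :: "nat \<Rightarrow> nat \<Rightarrow> 'q set" where "Yr \<equiv> Yrank H m n FA FG"
abbreviation Xr :: "nat \<Rightarrow> nat \<Rightarrow> nat \<Rightarrow> 'q set"
  where "Xr a b i \<equiv> Xset H m n FA FG a b (Yr a (i - 1))"
abbreviation Wr :: "nat \<Rightarrow> nat \<Rightarrow> nat \<Rightarrow> nat \<Rightarrow> 'q set" where "Wr \<equiv> Wrank H m n FA FG"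
abbreviation rk :: "nat \<Rightarrow> nat \<Rightarrow> 'q \<Rightarrow> nat \<times> nat \<Rightarrow> bool" where "rk \<equiv> rank_is H m n FA FG"
abbreviation rkd :: "nat \<Rightarrow> nat \<Rightarrow> 'q \<Rightarrow> bool" where "rkd \<equiv> ranked H m n FA FG"

lemma Xset_unfold:
  "Xset H m n FA FG a b Y = lfp (Om H FA FG a b (Zi (nxt n a)) Y (Xset H m n FA FG a b Y))"
  unfolding Xset_def by (rule gfp_unfold[OF mono_lfp_Om])

lemma Xset_fixpoint:
  "Xset H m n FA FG a b Y =
    Om H FA FG a b (Zi (nxt n a)) Y (Xset H m n FA FG a b Y) (Xset H m n FA FG a b Y)"
  using Xset_unfold lfp_unfold[OF mono_Om] by metis

lemma Xset_subset_states: "Xset H m n FA FG a b Y \<subseteq> states H"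
  using Xset_fixpoint Om_subset_states by metis

lemma mono_Union_Xset: "mono (\<lambda>Y. \<Union>b\<in>{1..m}. Xset H m n FA FG a b Y)"
  unfolding Xset_def by (rule mono_gfp_Om)

lemma Yr_funpow: "Yr a i = ((\<lambda>Y. \<Union>b\<in>{1..m}. Xset H m n FA FG a b Y) ^^ i) {}"
  by (induction i) simp_all

lemma Zi_eq_Union_Yr:
  assumes "a \<in> {1..n}"
  shows "Zi a = (\<Union>i. Yr a i)"
  unfolding Zinf_unfold[OF assms] Yr_funpow
  by (rule lfp_eq_Union_funpow[OF mono_Union_Xset finite_states]) (use Xset_subset_states in blast)

lemma Yr_mono: "i \<le> k \<Longrightarrow> Yr a i \<subseteq> Yr a k"
proof (rule lift_Suc_mono_le)
  show "Yr a i \<subseteq> Yr a (Suc i)" for i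
  proof (induction i)
    case (Suc i)
    then show ?case
      using monoD[OF mono_Union_Xset[of a], of "Yr a i" "Yr a (Suc i)"] by simp
  qed simp
qed

lemma Wr_funpow:
  "Wr a b i j = (Om H FA FG a b (Zi (nxt n a)) (Yr a (i - 1)) (Xr a b i) ^^ j) {}"
  by (induction j) simp_all

lemma Xr_eq_Union_Wr: "Xr a b i = (\<Union>j. Wr a b i j)"
  unfolding Wr_funpow
  by (subst Xset_unfold, rule lfp_eq_Union_funpow[OF mono_Om finite_states Om_subset_states])

lemma Wr_mono: "j \<le> k \<Longrightarrow> Wr a b i j \<subseteq> Wr a b i k"
proof (rule lift_Suc_mono_le)
  show "Wr a b i j \<subseteq> Wr a b i (Suc j)" for j
  proof (induction j)
    case (Suc j)
    then show ?case unfolding Wrank.simps(2) by (intro Om_mono order_refl)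
  qed simp
qed

lemma Yr_not_prev:
  assumes "q \<in> Yr a i"
  obtains i' where "0 < i'" "i' \<le> i" "q \<in> Yr a i' - Yr a (i' - 1)"
proof -
  define i' where "i' = (LEAST i. q \<in> Yr a i)"
  have "q \<in> Yr a i'" unfolding i'_def using assms by (rule LeastI)
  moreover from this have "0 < i'" by (cases i') auto
  moreover from this have "q \<notin> Yr a (i' - 1)" unfolding i'_def by (intro not_less_Least) simp
  moreover have "i' \<le> i" unfolding i'_def using assms by (rule Least_le)
  ultimately show ?thesis using that by blast
qed

lemma rk_in_Wr:
  assumes "q \<in> Yr a i - Yr a (i - 1)" "0 < i" "q \<in> Wr a b i j"
  obtains j' where "j' \<le> j" "rk a b q (i, j')"
proof -
  define j' where "j' = (LEAST j. q \<in> Wr a b i j)"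
  have "q \<in> Wr a b i j'" unfolding j'_def using assms(3) by (rule LeastI)
  moreover from this have "0 < j'" by (cases j') auto
  moreover from this have "q \<notin> Wr a b i (j' - 1)" unfolding j'_def by (intro not_less_Least) simp
  moreover have "j' \<le> j" unfolding j'_def using assms(3) by (rule Least_le)
  ultimately show ?thesis using that assms(1,2) by (auto simp: rank_is_def)
qed

lemma rkd_in_Xr:
  assumes "q \<in> Yr a i - Yr a (i - 1)" "0 < i" "q \<in> Xr a b i"
  shows "rkd a b q"
proof -
  obtain j where "q \<in> Wr a b i j" using assms(3) unfolding Xr_eq_Union_Wr by blast
  then show ?thesis using rk_in_Wr[OF assms(1,2)] unfolding ranked_def by metis
qed

lemma Yr_imp_rkd:
  assumes "q \<in> Yr a i"
  obtains b where "b \<in> {1..m}" "rkd a b q"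
proof -
  obtain i' where i': "0 < i'" "q \<in> Yr a i' - Yr a (i' - 1)" using Yr_not_prev[OF assms] by blast
  then obtain b where "b \<in> {1..m}" "q \<in> Xr a b i'" by (cases i') auto
  then show ?thesis using that rkd_in_Xr i' by blast
qed

lemma Zi_imp_rkd:
  assumes "a \<in> {1..n}" "q \<in> Zi a"
  obtains b where "b \<in> {1..m}" "rkd a b q"
  using assms Yr_imp_rkd unfolding Zi_eq_Union_Yr[OF assms(1)] by blast

lemma rk_imp_Yr: "rk a b q (i, j) \<Longrightarrow> q \<in> Yr a i"
  unfolding rank_is_def by simp

lemma rk_imp_Zi: "a \<in> {1..n} \<Longrightarrow> rk a b q (i, j) \<Longrightarrow> q \<in> Zi a"
  using rk_imp_Yr Zi_eq_Union_Yr by blast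

lemma rk_level_le:
  assumes "rk a b q (i, j)" "q \<in> Yr a k"
  shows "i \<le> k"
proof (rule ccontr)
  assume "\<not> i \<le> k"
  then have "Yr a k \<subseteq> Yr a (i - 1)" by (intro Yr_mono) auto
  then show False using assms unfolding rank_is_def by auto
qed

lemma rk_level_unique: "rk a b q (i, j) \<Longrightarrow> rk a b' q (i', j') \<Longrightarrow> i = i'"
  by (meson rk_level_le rk_imp_Yr le_antisym)

lemma rk_unique:
  assumes "rk a b q (i, j)" "rk a b q (i', j')"
  shows "i = i' \<and> j = j'"
proof -
  have i: "i = i'" using assms by (rule rk_level_unique)
  have "\<not> k < k'" if "rk a b q (i, k)" "rk a b q (i, k')" for k k'
  proof
    assume "k < k'"
    then have "Wr a b i k \<subseteq> Wr a b i (k' - 1)" by (intro Wr_mono) simp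
    then show False using that unfolding rank_is_def by auto
  qed
  then have "\<not> j < j'" "\<not> j' < j" using assms i by blast+
  then show ?thesis using i by simp
qed

lemma goal_subset_Wr: "0 < j \<Longrightarrow> FG a \<inter> Pre1 H (Zi (nxt n a)) \<subseteq> Wr a b i j"
  by (cases j) (auto simp: Om_def)

lemma Pre1_Yr_subset_Wr: "0 < j \<Longrightarrow> Pre1 H (Yr a (i - 1)) \<subseteq> Wr a b i j"
  by (cases j) (auto simp: Om_def)

lemma Xr_subset_Yr: "b \<in> {1..m} \<Longrightarrow> 0 < i \<Longrightarrow> Xr a b i \<subseteq> Yr a i"
  by (cases i) auto

lemma Wr_subset_Xr: "Wr a b i j \<subseteq> Xr a b i"
  unfolding Xr_eq_Union_Wr by (rule UN_upper) simp

lemma goal_subset_Yr: "FG a \<inter> Pre1 H (Zi (nxt n a)) \<subseteq> Yr a 1"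
proof -
  have "FG a \<inter> Pre1 H (Zi (nxt n a)) \<subseteq> Wr a 1 1 1" by (rule goal_subset_Wr) simp
  also have "\<dots> \<subseteq> Xr a 1 1" by (rule Wr_subset_Xr)
  also have "\<dots> \<subseteq> Yr a 1" using m_pos by (intro Xr_subset_Yr) auto
  finally show ?thesis .
qed

lemma Pre1_empty: "Pre1 H {} = {}"
  unfolding Pre1_def using env_live by blast

lemma rk_1:
  assumes "rk a b q (i, 1)"
  shows "i = 1 \<and> q \<in> FG a \<inter> Pre1 H (Zi (nxt n a)) \<or> 1 < i \<and> q \<in> Pre1 H (Yr a (i - 1))"
proof -
  have i: "0 < i" "q \<notin> Yr a (i - 1)" and "q \<in> Wr a b i 1"
    using assms unfolding rank_is_def by auto
  then have "q \<in> FG a \<inter> Pre1 H (Zi (nxt n a)) \<or> q \<in> Pre1 H (Yr a (i - 1))"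
    by (auto simp: Om_def CPre_def PreE_def)
  then consider "q \<in> FG a \<inter> Pre1 H (Zi (nxt n a))" | "q \<in> Pre1 H (Yr a (i - 1))" by blast
  then show ?thesis
  proof cases
    case 1
    then have "q \<in> Yr a 1" using goal_subset_Yr by blast
    then have "i \<le> 1" by (rule rk_level_le[OF assms])
    then have "i = 1" using i(1) by simp
    then show ?thesis using 1 by simp
  next
    case 2
    then have "i \<noteq> 1" using Pre1_empty by auto
    then show ?thesis using 2 i(1) by auto
  qed
qed

lemma rk_gt1:
  assumes "rk a b q (i, j)" "1 < j"
  shows "q \<notin> FA b" "q \<in> PreE H (Wr a b i (j - 1))" "q \<in> Pre1 H (Xr a b i)"
proof -
  obtain k where k: "j = Suc (Suc k)" using that[of "j - 2"] assms(2) by linarith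
  have q: "q \<in> Wr a b i j" "q \<notin> Wr a b i (j - 1)" using assms(1) unfolding rank_is_def by auto
  have "0 < j - 1" using assms(2) by simp
  then have "q \<notin> FG a \<inter> Pre1 H (Zi (nxt n a))" "q \<notin> Pre1 H (Yr a (i - 1))"
    using q(2) goal_subset_Wr[of "j - 1" a b i] Pre1_Yr_subset_Wr[of "j - 1" a i b] by blast+
  then have *: "q \<notin> FA b" "q \<in> CPre H (Wr a b i (j - 1)) (Xr a b i - FA b)"
    using q(1) unfolding k by (auto simp: Om_def)
  then show "q \<notin> FA b" "q \<in> PreE H (Wr a b i (j - 1))" by (auto simp: CPre_def)
  have "Wr a b i (j - 1) \<union> (Xr a b i - FA b) \<subseteq> Xr a b i" using Wr_subset_Xr by blast
  then show "q \<in> Pre1 H (Xr a b i)" using * Pre1_mono unfolding CPre_def by blast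
qed



fun good :: "'q \<times> nat \<times> nat \<Rightarrow> bool" where
  "good (p, a, b) \<longleftrightarrow> a \<in> {1..n} \<and> b \<in> {1..m} \<and> rkd a b p"

fun cstep :: "('q \<times> nat \<times> nat \<Rightarrow> 'q \<times> nat \<times> nat) \<Rightarrow> 'q \<times> nat \<times> nat \<Rightarrow> 'q \<times> nat \<times> nat \<Rightarrow> bool" where
  "cstep f (p, a, b) (p', a', b') \<longleftrightarrow> edge H p p' \<and>
    (\<exists>b0\<in>{1..m}. mode_step H m n FA FG f (p, a, b) (p', a', b0) \<and> (rkd a' b0 p' \<longrightarrow> b' = b0))"

fun crk :: "'q \<times> nat \<times> nat \<Rightarrow> nat \<times> nat \<Rightarrow> bool" where
  "crk (p, a, b) r \<longleftrightarrow> rk a b p r"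

lemma good_crk: "good c \<Longrightarrow> \<exists>i j. crk c (i, j)"
  by (cases c) (auto simp: ranked_def)

lemma crk_unique: "crk c (i, j) \<Longrightarrow> crk c (i', j') \<Longrightarrow> i = i' \<and> j = j'"
  by (cases c) (use rk_unique in auto)

lemma mode_plays_iff:
  "\<pi> \<in> mode_plays H m n FA FG q f \<longleftrightarrow>
    (\<exists>c. \<pi> = (\<lambda>k. fst (c k)) \<and> fst (c 0) = q \<and> (\<forall>k. good (c k) \<and> cstep f (c k) (c (Suc k))))"
    (is "?L \<longleftrightarrow> ?R")
proof
  assume ?L
  then obtain \<alpha> \<beta> where "\<pi> \<in> plays H q" "\<forall>k. \<alpha> k \<in> {1..n} \<and> \<beta> k \<in> {1..m} \<and>
        rkd (\<alpha> k) (\<beta> k) (\<pi> k) \<and>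
        (\<exists>b'\<in>{1..m}.
           mode_step H m n FA FG f (\<pi> k, \<alpha> k, \<beta> k) (\<pi> (Suc k), \<alpha> (Suc k), b') \<and>
           (rkd (\<alpha> (Suc k)) b' (\<pi> (Suc k)) \<longrightarrow> \<beta> (Suc k) = b'))"
    unfolding mode_plays_def by blast
  then show ?R by (intro exI[of _ "\<lambda>k. (\<pi> k, \<alpha> k, \<beta> k)"]) (simp add: plays_def)
next
  assume ?R
  then obtain c where c: "\<pi> = (\<lambda>k. fst (c k))" "fst (c 0) = q"
    "\<And>k. good (c k)" "\<And>k. cstep f (c k) (c (Suc k))" by blast
  define \<alpha> \<beta> where "\<alpha> k = fst (snd (c k))" and "\<beta> k = snd (snd (c k))" for k
  have ck: "c k = (\<pi> k, \<alpha> k, \<beta> k)" for k unfolding c \<alpha>_def \<beta>_def by simp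
  have "\<pi> \<in> plays H q" using c(2) c(4)[unfolded ck] ck by (simp add: plays_def)
  then show ?L
    using c(3,4)[unfolded ck] unfolding mode_plays_def good.simps cstep.simps by blast
qed

lemma cstep_cases:
  assumes f: "mode_strategy H m n FA FG f"
    and g: "good (p, a, b)" "good (p', a', b')" and c: "cstep f (p, a, b) (p', a', b')"
    and r: "rk a b p (i, j)" "rk a' b' p' (i', j')"
  shows "(i, j) = (1, 1) \<and> p \<in> FG a \<and> a' = nxt n a \<or>
    (i, j) \<noteq> (1, 1) \<and> a' = a \<and> (i' < i \<or> i' = i \<and> b' = b \<and> p \<notin> FA b)"
proof -
  obtain b0 where b0: "b0 \<in> {1..m}" "mode_step H m n FA FG f (p, a, b) (p', a', b0)"
    "rkd a' b0 p' \<longrightarrow> b' = b0" and e: "edge H p p'" using c by auto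
  have ij: "0 < i" "0 < j" using r(1) by (auto simp: rank_is_def)
  have pZ: "p \<in> Zi a" using rk_imp_Zi r(1) g(1) by auto
  have ab: "a \<in> {1..n}" "b \<in> {1..m}" using g(1) by auto
  have S: "(rk a b p (1, 1) \<longrightarrow> p' \<in> Zi (nxt n a) \<and> a' = nxt n a) \<and>
          (\<forall>i>1. rk a b p (i, 1) \<longrightarrow>
             (\<exists>i' j'. rk a' b0 p' (i', j') \<and> i' \<le> i - 1) \<and> a' = a) \<and>
          (\<forall>i. \<forall>j>1. rk a b p (i, j) \<longrightarrow>
             (\<exists>i' j'. rk a' b0 p' (i', j') \<and>
                (i' < i \<or> i' = i \<and> j' \<le> j - 1)) \<and>
             a' = a \<and> b0 = b)" if "p \<in> sys H"
  proof -
    have "(p', a', b0) = f (p, a, b)" using b0(2) that unfolding mode_step_def by simp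
    then show ?thesis using f pZ ab that unfolding mode_strategy_def by blast
  qed
  have E: "(rk a b p (1, 1) \<longrightarrow> a' = nxt n a) \<and>
        (\<forall>i>1. rk a b p (i, 1) \<longrightarrow> a' = a) \<and>
        (\<forall>i. \<forall>j>1. rk a b p (i, j) \<longrightarrow> a' = a \<and> b0 = b)" if "p \<in> env H"
    using b0(2) that unfolding mode_step_def by blast
  consider "p \<in> sys H" | "p \<in> env H" "p' \<in> env_trans H p" using e unfolding edge_def by blast
  note pc = this
  consider "(i, j) = (1, 1)" | "1 < i" "j = 1" | "1 < j" using ij by force
  then show ?thesis
  proof cases
    case 1
    then have "p \<in> FG a" using rk_1 r(1) by auto
    moreover have "a' = nxt n a" using pc 1 r(1) S E by cases auto
    ultimately show ?thesis using 1 by simp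
  next
    case 2
    have a': "a' = a" using pc 2 r(1) S E by cases auto
    have "p' \<in> Yr a (i - 1)" using pc
    proof cases
      case 1
      then obtain k l where "rk a' b0 p' (k, l)" "k \<le> i - 1" using S 2 r(1) by blast
      then show ?thesis using rk_imp_Yr Yr_mono a' by blast
    next
      case e: 2
      then have "p \<in> Pre1 H (Yr a (i - 1))" using rk_1 r(1) 2 by auto
      then show ?thesis using e env_sys_disjoint by (auto simp: Pre1_def)
    qed
    then have "i' \<le> i - 1" using rk_level_le r(2) a' by blast
    then show ?thesis using 2 a' by auto
  next
    case 3
    have a': "a' = a" "b0 = b" using pc 3 r(1) S E by (cases, blast, blast)+
    have "i' < i \<or> i' = i \<and> b' = b" using pc
    proof cases
      case 1
      then obtain k l where "rk a' b0 p' (k, l)" "k \<le> i" using S 3 r(1)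
        by (metis less_imp_le order_refl)
      moreover from this have "b' = b0" using b0(3) unfolding ranked_def by blast
      ultimately show ?thesis using rk_level_unique r(2) a' by (metis le_neq_implies_less)
    next
      case e: 2
      then have X: "p' \<in> Xr a b i"
        using rk_gt1(3)[OF r(1) 3] env_sys_disjoint by (auto simp: Pre1_def)
      then have "p' \<in> Yr a i" using Xr_subset_Yr ab(2) ij(1) by blast
      then have "i' \<le> i" using rk_level_le r(2) a' by blast
      moreover have "b' = b" if "i' = i"
      proof -
        have "p' \<in> Yr a i - Yr a (i - 1)" using r(2) that a' unfolding rank_is_def by auto
        then have "rkd a b p'" using rkd_in_Xr X ij(1) by blast
        then show ?thesis using b0(3) a' by simp
      qed
      ultimately show ?thesis by auto
    qed
    then show ?thesis using 3 a' rk_gt1(1)[OF r(1) 3] by auto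
  qed
qed

definition clt :: "'q \<times> nat \<times> nat \<Rightarrow> 'q \<times> nat \<times> nat \<Rightarrow> bool" where
  "clt c' c \<longleftrightarrow> (\<exists>i j i' j'. crk c (i, j) \<and> crk c' (i', j') \<and> (i' < i \<or> i' = i \<and> j' < j))"

lemma cstep_descend_exists:
  assumes f: "mode_strategy H m n FA FG f" and g: "good c"
  obtains c' where "good c'" "cstep f c c'" "crk c (1, 1) \<or> clt c' c"
proof -
  note result = that
  obtain p a b where c: "c = (p, a, b)" by (cases c) auto
  obtain i j where r: "rk a b p (i, j)" using good_crk[OF g] c by auto
  have ij: "0 < i" "0 < j" using r by (auto simp: rank_is_def)
  have pZ: "p \<in> Zi a" using rk_imp_Zi r g c by auto
  have ab: "a \<in> {1..n}" "b \<in> {1..m}" using g c by auto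
  have key: thesis
    if s: "edge H p p'" "b0 \<in> {1..m}" "mode_step H m n FA FG f (p, a, b) (p', a', b0)" "a' \<in> {1..n}"
      "p' \<in> Zi a'"
      and d: "(i, j) = (1, 1) \<or> (a' = a \<and> p' \<in> Yr a (i - 1)) \<or>
        (\<exists>j'<j. rk a' b0 p' (i, j'))" for p' a' b0
  proof -
    obtain b' where b': "b' \<in> {1..m}" "rkd a' b' p'" "rkd a' b0 p' \<longrightarrow> b' = b0"
      using Zi_imp_rkd[OF s(4,5)] s(2) by metis
    have "good (p', a', b')" "cstep f c (p', a', b')" using s b' c by auto
    moreover have "crk c (1, 1) \<or> clt (p', a', b') c"
      using d
    proof (elim disjE conjE exE)
      assume "a' = a" "p' \<in> Yr a (i - 1)"
      moreover obtain i' j' where r': "rk a' b' p' (i', j')" using b'(2) unfolding ranked_def by auto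
      ultimately have "i' \<le> i - 1" using rk_level_le by blast
      then have "clt (p', a', b') c"
        unfolding clt_def c crk.simps using r r' ij by (metis Suc_pred' le_imp_less_Suc)
      then show ?thesis by simp
    next
      fix j' assume "j' < j" "rk a' b0 p' (i, j')"
      then have "clt (p', a', b') c"
        unfolding clt_def c crk.simps using r b'(3) unfolding ranked_def by blast
      then show ?thesis by simp
    qed (use r c in auto)
    ultimately show thesis by (rule result)
  qed
  have Yr_Zi: "Yr a k \<subseteq> Zi a" for k using Zi_eq_Union_Yr[OF ab(1)] by blast
  consider (sys) "p \<in> sys H" | (env) "p \<in> env H"
    using r Xset_subset_states Xr_subset_Yr rk_imp_Yr[OF r] ij(1)
    by (cases i) (auto simp: states_def)
  then show thesis
  proof cases
    case sys
    obtain p' a' b0 where fe: "(p', a', b0) = f (p, a, b)" by (metis prod_cases3)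
    have S: "p' \<in> env H" "a' \<in> {1..n}" "b0 \<in> {1..m}" "p' \<in> sys_trans H p"
      "rk a b p (1, 1) \<longrightarrow> p' \<in> Zi (nxt n a) \<and> a' = nxt n a"
      "\<forall>i>1. rk a b p (i, 1) \<longrightarrow>
             (\<exists>i' j'. rk a' b0 p' (i', j') \<and> i' \<le> i - 1) \<and> a' = a"
      "\<forall>i. \<forall>j>1. rk a b p (i, j) \<longrightarrow>
             (\<exists>i' j'. rk a' b0 p' (i', j') \<and>
                (i' < i \<or> i' = i \<and> j' \<le> j - 1)) \<and>
             a' = a \<and> b0 = b"
      using f pZ ab sys fe unfolding mode_strategy_def by blast+
    have ms: "mode_step H m n FA FG f (p, a, b) (p', a', b0)"
      using fe sys env_sys_disjoint unfolding mode_step_def by auto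
    have e: "edge H p p'" using sys S(4) unfolding edge_def by simp
    consider "(i, j) = (1, 1)" | "1 < i" "j = 1" | "1 < j" using ij by force
    then show thesis
    proof cases
      case 1
      then show ?thesis using key[OF e S(3) ms S(2)] S(5) r by simp
    next
      case 2
      then obtain k l where kl: "rk a' b0 p' (k, l)" "k \<le> i - 1" "a' = a" using S(6) r by blast
      then have "p' \<in> Yr a (i - 1)" using rk_imp_Yr Yr_mono by blast
      then show ?thesis using key[OF e S(3) ms S(2)] kl Yr_Zi by blast
    next
      case 3
      then obtain k l where kl: "rk a' b0 p' (k, l)" "k < i \<or> k = i \<and> l \<le> j - 1" "a' = a"
        using S(7) r by blast
      have "p' \<in> Zi a'" using rk_imp_Zi kl(1) S(2) by blast
      moreover have "(a' = a \<and> p' \<in> Yr a (i - 1)) \<or> (\<exists>j'<j. rk a' b0 p' (i, j'))"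
      proof (cases "k < i")
        case True
        then have "k \<le> i - 1" by simp
        then show ?thesis using rk_imp_Yr[OF kl(1)] Yr_mono kl(3) by blast
      next
        case False
        then show ?thesis using kl 3 by (metis One_nat_def Suc_pred' ij(2) le_imp_less_Suc)
      qed
      ultimately show ?thesis using key[OF e S(3) ms S(2)] by blast
    qed
  next
    case env
    have e: "edge H p p'" if "p' \<in> env_trans H p" for p' using env that unfolding edge_def by simp
    have Pre1: "env_trans H p \<subseteq> P" if "p \<in> Pre1 H P" for P
      using that env env_sys_disjoint unfolding Pre1_def by auto
    have ms: "mode_step H m n FA FG f (p, a, b) (p', a', b0)"
      if "(i, j) = (1, 1) \<and> a' = nxt n a \<or> (i, j) \<noteq> (1, 1) \<and> a' = a \<and> b0 = b" for p' a' b0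
      using that env env_sys_disjoint rk_unique[OF r] unfolding mode_step_def by auto
    consider "(i, j) = (1, 1)" | "1 < i" "j = 1" | "1 < j" using ij by force
    then show thesis
    proof cases
      case 1
      obtain p' where p': "p' \<in> env_trans H p" using env_live[OF env] by blast
      have "p \<in> Pre1 H (Zi (nxt n a))" using rk_1 r 1 by auto
      then have "p' \<in> Zi (nxt n a)" using Pre1 p' by blast
      then show ?thesis using key[OF e[OF p'] ab(2) ms] 1 nxt_in_range[OF n_pos] by blast
    next
      case 2
      obtain p' where p': "p' \<in> env_trans H p" using env_live[OF env] by blast
      have "p \<in> Pre1 H (Yr a (i - 1))" using rk_1 r 2 by auto
      then have "p' \<in> Yr a (i - 1)" using Pre1 p' by blast
      then show ?thesis using key[OF e[OF p'] ab(2) ms ab(1)] 2 Yr_Zi by blast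
    next
      case 3
      obtain p' where p': "p' \<in> env_trans H p" "p' \<in> Wr a b i (j - 1)"
        using rk_gt1(2)[OF r 3] env env_sys_disjoint unfolding PreE_def by auto
      then have "p' \<in> Xr a b i" using Wr_subset_Xr by blast
      then have Y: "p' \<in> Yr a i" using Xr_subset_Yr ab(2) ij(1) by blast
      have "p' \<in> Yr a (i - 1) \<or> (\<exists>j'<j. rk a b p' (i, j'))"
        using rk_in_Wr[OF _ ij(1) p'(2)] Y ij(2)
        by (metis Diff_iff Suc_pred' le_imp_less_Suc)
      then show ?thesis using key[OF e[OF p'(1)] ab(2) ms ab(1)] 3 Y Yr_Zi by blast
    qed
  qed
qed

lemma crk11_infinitely_often_imp_goals:
  assumes f: "mode_strategy H m n FA FG f"
    and c: "\<And>k. good (c k)" "\<And>k. cstep f (c k) (c (Suc k))"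
    and io: "\<exists>\<^sub>\<infinity>k. crk (c k) (1, 1)"
    and d: "d \<in> {1..n}"
  shows "\<exists>\<^sub>\<infinity>k. fst (c k) \<in> FG d"
proof -
  define \<alpha> where "\<alpha> k = fst (snd (c k))" for k
  have \<alpha>: "\<alpha> k \<in> {1..n}" for k using c(1)[of k] unfolding \<alpha>_def by (cases "c k") auto
  have cs: "if crk (c k) (1, 1) then fst (c k) \<in> FG (\<alpha> k) \<and> \<alpha> (Suc k) = nxt n (\<alpha> k)
    else \<alpha> (Suc k) = \<alpha> k" for k
  proof -
    obtain p a b p' a' b' where e: "c k = (p, a, b)" "c (Suc k) = (p', a', b')"
      by (metis prod_cases3)
    obtain i j i' j' where r: "rk a b p (i, j)" "rk a' b' p' (i', j')"
      using good_crk[OF c(1)[of k]] good_crk[OF c(1)[of "Suc k"]] e by auto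
    have "crk (c k) (1, 1) \<longleftrightarrow> (i, j) = (1, 1)"
      using rk_unique[OF r(1), of 1 1] r(1) unfolding e crk.simps by blast
    moreover have "(i, j) = (1, 1) \<and> p \<in> FG a \<and> a' = nxt n a \<or> (i, j) \<noteq> (1, 1) \<and> a' = a"
      using cstep_cases[OF f _ _ _ r] c[of k] c(1)[of "Suc k"] unfolding e by blast
    ultimately show ?thesis unfolding \<alpha>_def e fst_conv snd_conv by presburger
  qed
  define A where "A = {a \<in> {1..n}. \<exists>\<^sub>\<infinity>k. crk (c k) (1, 1) \<and> \<alpha> k = a}"
  have "\<exists>\<^sub>\<infinity>k. \<exists>a\<in>{1..n}. crk (c k) (1, 1) \<and> \<alpha> k = a"
    using io by (rule frequently_mono[rotated]) (use \<alpha> in auto)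
  then have "\<exists>a\<in>{1..n}. \<exists>\<^sub>\<infinity>k. crk (c k) (1, 1) \<and> \<alpha> k = a"
    by (rule frequently_bex_finite[rotated]) simp
  then obtain a where a: "a \<in> A" unfolding A_def by blast
  have closed: "nxt n a \<in> A" if "a \<in> A" for a
  proof -
    have "\<exists>k\<ge>K. crk (c k) (1, 1) \<and> \<alpha> k = nxt n a" for K
    proof -
      obtain k where k: "k \<ge> K" "crk (c k) (1, 1)" "\<alpha> k = a"
        using \<open>a \<in> A\<close> unfolding A_def INFM_nat_le by blast
      define l where "l = (LEAST l. l \<ge> Suc k \<and> crk (c l) (1, 1))"
      have "\<exists>l. l \<ge> Suc k \<and> crk (c l) (1, 1)" using io unfolding INFM_nat_le by blast
      then have l: "l \<ge> Suc k" "crk (c l) (1, 1)" unfolding l_def by (metis (mono_tags, lifting) LeastI)+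
      have "\<alpha> x = nxt n a" if "Suc k \<le> x" "x \<le> l" for x
        using that
      proof (induction x rule: dec_induct)
        case base
        then show ?case using cs[of k] k by simp
      next
        case (step x)
        then have "x < l" "Suc k \<le> x" by simp_all
        then have "\<not> crk (c x) (1, 1)" using not_less_Least unfolding l_def by blast
        then show ?case using step.IH \<open>x < l\<close> cs[of x] by simp
      qed
      then have "\<alpha> l = nxt n a" using l by simp
      then show ?thesis using l k by (intro exI[of _ l]) simp
    qed
    then show ?thesis unfolding A_def INFM_nat_le using nxt_in_range[OF n_pos] by blast
  qed
  have "A \<subseteq> {1..n}" unfolding A_def by blast
  then have "d \<in> A" using nxt_closed_imp_all a closed d by blast
  then have "\<exists>\<^sub>\<infinity>k. crk (c k) (1, 1) \<and> \<alpha> k = d" unfolding A_def by blast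
  then show ?thesis
  proof (rule frequently_mono[rotated], intro allI impI)
    fix k
    assume "crk (c k) (1, 1) \<and> \<alpha> k = d"
    then show "fst (c k) \<in> FG d" using cs[of k] by simp
  qed
qed

lemma crk11_finitely_often_imp_unfair:
  assumes f: "mode_strategy H m n FA FG f"
    and c: "\<And>k. good (c k)" "\<And>k. cstep f (c k) (c (Suc k))"
    and fo: "\<not> (\<exists>\<^sub>\<infinity>k. crk (c k) (1, 1))"
  shows "\<exists>b\<in>{1..m}. \<not> (\<exists>\<^sub>\<infinity>k. fst (c k) \<in> FA b)"
proof -
  obtain \<pi> \<alpha> \<beta> where ck: "\<And>k. c k = (\<pi> k, \<alpha> k, \<beta> k)"
    using that[of "\<lambda>k. fst (c k)" "\<lambda>k. fst (snd (c k))" "\<lambda>k. snd (snd (c k))"] by simp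
  obtain K where K: "\<And>k. k \<ge> K \<Longrightarrow> \<not> crk (c k) (1, 1)" using fo unfolding INFM_nat_le by blast
  obtain I J where r: "\<And>k. rk (\<alpha> k) (\<beta> k) (\<pi> k) (I k, J k)"
    using good_crk[OF c(1)] unfolding ck crk.simps by metis
  have cs: "\<alpha> (Suc k) = \<alpha> k \<and> (I (Suc k) < I k \<or>
    I (Suc k) = I k \<and> \<beta> (Suc k) = \<beta> k \<and> \<pi> k \<notin> FA (\<beta> k))" if "k \<ge> K" for k
    using cstep_cases[OF f c(1)[of k, unfolded ck] c(1)[of "Suc k", unfolded ck]
        c(2)[of k, unfolded ck] r r] K[OF that] r[of k] unfolding ck crk.simps by auto
  obtain L where L: "L \<ge> K" "\<And>k. k \<ge> K \<Longrightarrow> I L \<le> I k"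
    using ex_has_least_nat[of "\<lambda>k. k \<ge> K" K I] by blast
  have inv: "I k = I L \<and> \<beta> k = \<beta> L" if "k \<ge> L" for k
    using that
  proof (induction k rule: dec_induct)
    case (step k)
    then show ?case using cs[of k] L(1) L(2)[of "Suc k"] by auto
  qed simp
  have "\<pi> k \<notin> FA (\<beta> L)" if "k \<ge> L" for k
    using cs[of k] inv[of k] inv[of "Suc k"] L(1) that by auto
  moreover have "\<beta> L \<in> {1..m}" using c(1)[of L] unfolding ck by simp
  ultimately show ?thesis unfolding ck fst_conv INFM_nat_le by blast
qed

lemma clt_chain_crk11:
  assumes "\<And>k. crk (C k) (1, 1) \<or> clt (C (Suc k)) (C k)"
  shows "\<exists>\<^sub>\<infinity>k. crk (C k) (1, 1)"
proof (rule ccontr)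
  assume "\<not> ?thesis"
  then obtain K where K: "\<And>k. k \<ge> K \<Longrightarrow> \<not> crk (C k) (1, 1)" unfolding INFM_nat_le by blast
  define R where "R = {(c', c). clt c' c}"
  have "wf R"
  proof (rule wf_subset)
    let ?r = "\<lambda>c. SOME r. crk c r"
    show "wf (inv_image (less_than <*lex*> less_than) ?r)" by (intro wf_inv_image wf_lex_prod) auto
    have "?r c = (i, j)" if "crk c (i, j)" for c i j
      using that
    proof (rule some_equality)
      fix r
      assume "crk c r"
      then show "r = (i, j)" using crk_unique[OF that] by (cases r) auto
    qed
    then show "R \<subseteq> inv_image (less_than <*lex*> less_than) ?r"
      unfolding R_def clt_def by fastforce
  qed
  moreover have "(C (Suc k + K), C (k + K)) \<in> R" for k
    using assms[of "k + K"] K[of "k + K"] unfolding R_def by auto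
  ultimately show False
    unfolding wf_iff_no_infinite_down_chain by (elim notE) (rule exI[of _ "\<lambda>k. C (k + K)"], blast)
qed

lemma good_continuation:
  assumes f: "mode_strategy H m n FA FG f" and g: "good c"
  shows "\<exists>C. C 0 = c \<and> (\<forall>k. good (C k) \<and> cstep f (C k) (C (Suc k))) \<and>
    (\<exists>\<^sub>\<infinity>k. crk (C k) (1, 1))"
proof -
  have "\<exists>C. \<forall>k. (good (C k) \<and> (k = 0 \<longrightarrow> C k = c)) \<and>
    (cstep f (C k) (C (Suc k)) \<and> (crk (C k) (1, 1) \<or> clt (C (Suc k)) (C k)))"
  proof (rule dependent_nat_choice)
    show "\<exists>x. good x \<and> (0 = (0::nat) \<longrightarrow> x = c)" using g by blast
    show "\<exists>y. (good y \<and> (Suc k = 0 \<longrightarrow> y = c)) \<and> cstep f x y \<and> (crk x (1, 1) \<or> clt y x)"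
      if "good x \<and> (k = 0 \<longrightarrow> x = c)" for x k
      using cstep_descend_exists[OF f] that by (metis nat.distinct(1))
  qed
  then obtain C where "C 0 = c" "\<And>k. good (C k)" "\<And>k. cstep f (C k) (C (Suc k))"
    "\<And>k. crk (C k) (1, 1) \<or> clt (C (Suc k)) (C k)" by blast
  then show ?thesis using clt_chain_crk11[of C] by blast
qed

lemma mode_plays_subset_plays: "mode_plays H m n FA FG q f \<subseteq> plays H q"
  unfolding mode_plays_def by blast



lemma mode_plays_sound:
  assumes f: "mode_strategy H m n FA FG f"
  shows "mode_plays H m n FA FG q f
    \<subseteq> compl_lang H (buechi_plays H q m FA) \<union> buechi_plays H q n FG"
proof
  fix \<pi>
  assume \<pi>: "\<pi> \<in> mode_plays H m n FA FG q f"
  then obtain c where c: "\<pi> = (\<lambda>k. fst (c k))" "\<And>k. good (c k)" "\<And>k. cstep f (c k) (c (Suc k))"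
    unfolding mode_plays_iff by blast
  have p: "\<pi> \<in> plays H q" using \<pi> mode_plays_subset_plays by blast
  show "\<pi> \<in> compl_lang H (buechi_plays H q m FA) \<union> buechi_plays H q n FG"
  proof (cases "\<exists>\<^sub>\<infinity>k. crk (c k) (1, 1)")
    case True
    then have "\<forall>d\<in>{1..n}. \<exists>\<^sub>\<infinity>k. \<pi> k \<in> FG d"
      using crk11_infinitely_often_imp_goals[of f c, OF f c(2,3)] unfolding c(1) by blast
    then show ?thesis using p unfolding buechi_plays_def by blast
  next
    case False
    then have "\<exists>b\<in>{1..m}. \<not> (\<exists>\<^sub>\<infinity>k. fst (c k) \<in> FA b)"
      using crk11_finitely_often_imp_unfair[of f c, OF f c(2,3)] by blast
    then have "\<pi> \<notin> buechi_plays H q m FA" unfolding buechi_plays_def c(1) by blast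
    then show ?thesis using compl_langI[OF p] by blast
  qed
qed

lemma mode_play_extend:
  assumes f: "mode_strategy H m n FA FG f" and \<pi>: "\<pi> \<in> mode_plays H m n FA FG q f"
  obtains \<pi>' where "\<pi>' \<in> mode_plays H m n FA FG q f" "\<pi>' \<in> buechi_plays H q n FG"
    "prefix k \<pi>' = prefix k \<pi>"
proof -
  obtain c where c: "\<pi> = (\<lambda>k. fst (c k))" "fst (c 0) = q"
    "\<And>k. good (c k)" "\<And>k. cstep f (c k) (c (Suc k))"
    using \<pi> unfolding mode_plays_iff by blast
  obtain C where C: "C 0 = c k" "\<And>k. good (C k)" "\<And>k. cstep f (C k) (C (Suc k))"
    "\<exists>\<^sub>\<infinity>k. crk (C k) (1, 1)" using good_continuation[OF f c(3)[of k]] by blast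
  define D where "D x = (if x < k then c x else C (x - k))" for x
  have D: "good (D x)" "cstep f (D x) (D (Suc x))" for x
  proof -
    show "good (D x)" using c C unfolding D_def by simp
    consider "Suc x < k" | "Suc x = k" | "x \<ge> k" by linarith
    then show "cstep f (D x) (D (Suc x))"
      using c(4)[of x] C(1) C(3)[of "x - k"]
      by cases (auto simp: D_def Suc_diff_le)
  qed
  have D0: "fst (D 0) = q" using c(2) C(1) unfolding D_def by auto
  let ?\<pi> = "\<lambda>x. fst (D x)"
  have mp: "?\<pi> \<in> mode_plays H m n FA FG q f" unfolding mode_plays_iff using D D0 by blast
  have "\<exists>\<^sub>\<infinity>x. crk (D x) (1, 1)"
    unfolding INFM_nat_le
  proof
    fix K
    obtain x where "x \<ge> K" "crk (C x) (1, 1)" using C(4) unfolding INFM_nat_le by blast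
    then show "\<exists>x\<ge>K. crk (D x) (1, 1)" by (intro exI[of _ "x + k"]) (simp add: D_def)
  qed
  then have "?\<pi> \<in> buechi_plays H q n FG"
    using crk11_infinitely_often_imp_goals[of f D, OF f D] mp mode_plays_subset_plays
    unfolding buechi_plays_def by blast
  moreover have "prefix k ?\<pi> = prefix k \<pi>" unfolding prefix_def c(1) D_def by simp
  ultimately show ?thesis using that mp by blast
qed

lemma mode_plays_nonempty:
  assumes f: "mode_strategy H m n FA FG f" and q: "q \<in> phi4 H m n FA FG"
  shows "mode_plays H m n FA FG q f \<noteq> {}"
proof -
  obtain a b where "good (q, a, b)" using q Zi_imp_rkd unfolding phi4_def by (metis UN_E good.simps)
  then obtain C where "C 0 = (q, a, b)" "\<And>k. good (C k)" "\<And>k. cstep f (C k) (C (Suc k))"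
    using good_continuation[OF f] by blast
  then have "(\<lambda>k. fst (C k)) \<in> mode_plays H m n FA FG q f" unfolding mode_plays_iff
    by (intro exI[of _ C]) simp
  then show ?thesis by blast
qed

end

subsection \<open>Plays of a winning, non-blocking strategy\<close>

lemma prefix_eq_iff: "prefix k \<pi> = prefix k \<pi>' \<longleftrightarrow> (\<forall>x<k. \<pi> x = \<pi>' x)"
  unfolding prefix_def by auto

lemma prefix_Suc: "prefix (Suc k) \<pi> = prefix k \<pi> @ [\<pi> k]"
  unfolding prefix_def by simp

locale system_winning = gr1_game H m n FA FG
  for H :: "'q game" and m n :: nat and FA FG :: "nat \<Rightarrow> 'q set" +
  fixes q :: 'q and g :: "'q list \<Rightarrow> 'q"
  assumes q_state: "q \<in> states H"
    and strategy: "system_strategy H g"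
    and winning: "strategy_plays H q g
      \<subseteq> compl_lang H (buechi_plays H q m FA) \<union> buechi_plays H q n FG"
    and nonblocking: "pre (strategy_plays H q g)
      = pre (strategy_plays H q g \<inter> buechi_plays H q m FA)"
begin

abbreviation SP :: "(nat \<Rightarrow> 'q) set" where "SP \<equiv> strategy_plays H q g"

lemma SP_iff: "\<pi> \<in> SP \<longleftrightarrow> \<pi> 0 = q \<and> (\<forall>k. edge H (\<pi> k) (\<pi> (Suc k)) \<and>
    (\<pi> k \<in> sys H \<longrightarrow> \<pi> (Suc k) = g (prefix (Suc k) \<pi>)))"
  unfolding strategy_plays_def plays_def by blast



lemma SP_complete:
  assumes "\<pi> 0 = q" "\<And>x. x < k \<Longrightarrow> edge H (\<pi> x) (\<pi> (Suc x)) \<and>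
    (\<pi> x \<in> sys H \<longrightarrow> \<pi> (Suc x) = g (prefix (Suc x) \<pi>))"
  obtains \<pi>' where "\<pi>' \<in> SP" "\<And>x. x \<le> k \<Longrightarrow> \<pi>' x = \<pi> x"
proof -
  define P where "P l \<rho> \<longleftrightarrow> \<rho> 0 = q \<and> (\<forall>x<k + l. edge H (\<rho> x) (\<rho> (Suc x)) \<and>
    (\<rho> x \<in> sys H \<longrightarrow> \<rho> (Suc x) = g (prefix (Suc x) \<rho>)))" for l and \<rho> :: "nat \<Rightarrow> 'q"
  have "\<exists>R. \<forall>l. (P l (R l) \<and> (l = 0 \<longrightarrow> R l = \<pi>)) \<and> (\<forall>x\<le>k + l. R (Suc l) x = R l x)"
  proof (rule dependent_nat_choice)
    show "\<exists>\<rho>. P 0 \<rho> \<and> (0 = (0::nat) \<longrightarrow> \<rho> = \<pi>)" using assms unfolding P_def by auto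
    fix \<rho> l
    assume "P l \<rho> \<and> (l = 0 \<longrightarrow> \<rho> = \<pi>)"
    then have \<rho>: "\<rho> 0 = q" "\<And>x. x < k + l \<Longrightarrow> edge H (\<rho> x) (\<rho> (Suc x))"
      "\<And>x. x < k + l \<Longrightarrow> \<rho> x \<in> sys H \<Longrightarrow> \<rho> (Suc x) = g (prefix (Suc x) \<rho>)"
      unfolding P_def by auto
    have st: "\<rho> x \<in> states H" if "x \<le> k + l" for x
      using \<rho>(1) \<rho>(2)[of "x - 1"] edge_states q_state that by (cases x) auto
    have fp: "prefix (Suc (k + l)) \<rho> \<in> finite_plays H"
      unfolding finite_plays_def using st \<rho>(2) by (auto simp: prefix_def nth_append simp del: upt_Suc)
    obtain s where s: "edge H (\<rho> (k + l)) s" "\<rho> (k + l) \<in> sys H \<longrightarrow> s = g (prefix (Suc (k + l)) \<rho>)"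
    proof (cases "\<rho> (k + l) \<in> sys H")
      case True
      have "g (prefix (Suc (k + l)) \<rho>) \<in> sys_trans H (\<rho> (k + l))"
        using strategy fp True unfolding system_strategy_def by (auto simp: prefix_Suc)
      then show ?thesis using that True unfolding edge_def by blast
    next
      case False
      then have "\<rho> (k + l) \<in> env H" using st[of "k + l"] unfolding states_def by simp
      then show ?thesis using that env_live False unfolding edge_def by blast
    qed
    define \<rho>' where "\<rho>' = \<rho>(Suc (k + l) := s)"
    have pf: "prefix (Suc x) \<rho>' = prefix (Suc x) \<rho>" if "x \<le> k + l" for x
      unfolding prefix_eq_iff \<rho>'_def using that by auto
    have "P (Suc l) \<rho>'"
      unfolding P_def
    proof (intro conjI allI impI)
      show "\<rho>' 0 = q" using \<rho>(1) unfolding \<rho>'_def by simp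
      fix x
      assume "x < k + Suc l"
      then have x: "x \<le> k + l" by simp
      then have eq: "\<rho>' x = \<rho> x" unfolding \<rho>'_def by simp
      have eq': "\<rho>' (Suc x) = (if x = k + l then s else \<rho> (Suc x))" unfolding \<rho>'_def by simp
      show "edge H (\<rho>' x) (\<rho>' (Suc x))"
        using \<rho>(2)[of x] s(1) x unfolding eq eq' by simp
      assume "\<rho>' x \<in> sys H"
      then show "\<rho>' (Suc x) = g (prefix (Suc x) \<rho>')"
        using \<rho>(3)[of x] s(2) x unfolding eq eq' pf[OF x] by auto
    qed
    moreover have "\<forall>x\<le>k + l. \<rho>' x = \<rho> x" unfolding \<rho>'_def by simp
    ultimately show "\<exists>y. (P (Suc l) y \<and> (Suc l = 0 \<longrightarrow> y = \<pi>)) \<and> (\<forall>x\<le>k + l. y x = \<rho> x)" by blast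
  qed
  then obtain R where R: "R 0 = \<pi>" "\<And>l. P l (R l)"
    "\<And>l x. x \<le> k + l \<Longrightarrow> R (Suc l) x = R l x" by blast
  have agree: "R (l + d) x = R l x" if "x \<le> k + l" for l d x
    by (induction d) (use R(3) that in auto)
  define \<pi>' where "\<pi>' x = R x x" for x
  have \<pi>': "\<pi>' x = R l x" if "x \<le> k + l" for l x
  proof (cases "x \<le> l")
    case True
    then show ?thesis unfolding \<pi>'_def using agree[of x x "l - x"] by simp
  next
    case False
    then show ?thesis unfolding \<pi>'_def using agree[of x l "x - l"] that by simp
  qed
  have "\<pi>' \<in> SP"
    unfolding SP_iff
  proof (intro conjI allI impI)
    show "\<pi>' 0 = q" using \<pi>'[of 0 0] R(1) assms(1) by simp
    fix x
    have eq: "\<pi>' x = R (Suc x) x" "\<pi>' (Suc x) = R (Suc x) (Suc x)" using \<pi>' by auto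
    have pf: "prefix (Suc x) \<pi>' = prefix (Suc x) (R (Suc x))" unfolding prefix_eq_iff using \<pi>' by auto
    show "edge H (\<pi>' x) (\<pi>' (Suc x))" using R(2)[of "Suc x"] unfolding P_def eq by auto
    assume "\<pi>' x \<in> sys H"
    then show "\<pi>' (Suc x) = g (prefix (Suc x) \<pi>')"
      using R(2)[of "Suc x"] unfolding P_def pf eq by auto
  qed
  moreover have "\<pi>' x = \<pi> x" if "x \<le> k" for x using \<pi>'[of x 0] R(1) that by simp
  ultimately show ?thesis using that by blast
qed

lemma SP_deviate:
  assumes "\<pi> \<in> SP" "\<pi> k \<notin> Pre1 H P"
  obtains \<pi>' where "\<pi>' \<in> SP" "\<And>x. x \<le> k \<Longrightarrow> \<pi>' x = \<pi> x" "\<pi>' (Suc k) \<notin> P"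
proof -
  have e: "edge H (\<pi> k) (\<pi> (Suc k))" using assms(1) unfolding SP_iff by blast
  show ?thesis
  proof (cases "\<pi> k \<in> sys H")
    case True
    then have "\<pi> (Suc k) \<notin> P" using e assms(2) env_sys_disjoint unfolding edge_def Pre1_def by blast
    then show ?thesis using that assms(1) by blast
  next
    case False
    then obtain s where s: "s \<in> env_trans H (\<pi> k)" "s \<notin> P" "\<pi> k \<in> env H"
      using e assms(2) unfolding edge_def Pre1_def by blast
    define \<rho> where "\<rho> = \<pi>(Suc k := s)"
    have pf: "prefix (Suc x) \<rho> = prefix (Suc x) \<pi>" if "x \<le> k" for x
      unfolding prefix_eq_iff \<rho>_def using that by auto
    have "\<rho> 0 = q" using assms(1) unfolding SP_iff \<rho>_def by simp
    moreover have "edge H (\<rho> x) (\<rho> (Suc x)) \<and>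
        (\<rho> x \<in> sys H \<longrightarrow> \<rho> (Suc x) = g (prefix (Suc x) \<rho>))" if "x < Suc k" for x
    proof (cases "x = k")
      case True
      then show ?thesis using s False unfolding \<rho>_def edge_def by auto
    next
      case False
      then show ?thesis using that assms(1) pf[of x] unfolding SP_iff \<rho>_def by auto
    qed
    ultimately obtain \<pi>' where "\<pi>' \<in> SP" "\<And>x. x \<le> Suc k \<Longrightarrow> \<pi>' x = \<rho> x"
      using SP_complete[of \<rho> "Suc k"] by blast
    then show ?thesis using that[of \<pi>'] s(2) unfolding \<rho>_def by auto
  qed
qed

lemma SP_fair:
  assumes "\<pi> \<in> SP"
  obtains \<pi>' where "\<pi>' \<in> SP" "\<pi>' \<in> buechi_plays H q m FA" "\<And>x. x \<le> k \<Longrightarrow> \<pi>' x = \<pi> x"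
proof -
  have "prefix (Suc k) \<pi> \<in> pre SP"
    unfolding pre_def using assms by blast
  then have "prefix (Suc k) \<pi> \<in> pre (SP \<inter> buechi_plays H q m FA)"
    using nonblocking by simp
  then obtain l \<pi>' where \<pi>': "\<pi>' \<in> SP" "\<pi>' \<in> buechi_plays H q m FA" "prefix (Suc k) \<pi> = prefix l \<pi>'"
    unfolding pre_def by blast
  then have "length (prefix (Suc k) \<pi>) = length (prefix l \<pi>')" by simp
  then have "l = Suc k" by (simp add: prefix_def)
  then have "\<forall>x<Suc k. \<pi> x = \<pi>' x" using \<pi>'(3) prefix_eq_iff by metis
  then show ?thesis using that[OF \<pi>'(1,2)] by (simp add: less_Suc_eq_le)
qed

lemma SP_limit:
  assumes "\<And>i. \<Pi> i \<in> SP" "\<And>i. K i < K (Suc i)" "\<And>i x. x \<le> K i \<Longrightarrow> \<Pi> (Suc i) x = \<Pi> i x"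
  obtains \<pi> where "\<pi> \<in> SP" "\<And>i x. x \<le> K i \<Longrightarrow> \<pi> x = \<Pi> i x"
proof -
  have "strict_mono K" using assms(2) by (simp add: strict_mono_Suc_iff)
  then have Kmono: "K i \<le> K (i + d)" and Kge: "i \<le> K i" for i d
    by (simp_all add: strict_mono_less_eq strict_mono_imp_increasing)
  have agree: "\<Pi> (i + d) x = \<Pi> i x" if "x \<le> K i" for i d x
  proof (induction d)
    case (Suc d)
    have "x \<le> K (i + d)" using that Kmono[of i d] by simp
    then show ?case using assms(3)[of x "i + d"] Suc by simp
  qed simp
  define \<pi> where "\<pi> x = \<Pi> x x" for x
  have \<pi>: "\<pi> x = \<Pi> i x" if "x \<le> K i" for i x
  proof (cases "x \<le> i")
    case True
    then show ?thesis unfolding \<pi>_def using agree[of x x "i - x"] Kge by simp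
  next
    case False
    then show ?thesis unfolding \<pi>_def using agree[of x i "x - i"] that by simp
  qed
  have "\<pi> \<in> SP"
    unfolding SP_iff
  proof (intro conjI allI impI)
    show "\<pi> 0 = q" using \<pi>[of 0 0] assms(1) unfolding SP_iff by simp
    fix x
    have K: "y \<le> K (Suc x)" if "y \<le> Suc x" for y using Kge[of "Suc x"] that by simp
    have eq: "\<pi> x = \<Pi> (Suc x) x" "\<pi> (Suc x) = \<Pi> (Suc x) (Suc x)" using \<pi> K by auto
    have pf: "prefix (Suc x) \<pi> = prefix (Suc x) (\<Pi> (Suc x))" unfolding prefix_eq_iff using \<pi> K by auto
    show "edge H (\<pi> x) (\<pi> (Suc x))" using assms(1)[of "Suc x"] unfolding SP_iff eq by blast
    assume "\<pi> x \<in> sys H"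
    then show "\<pi> (Suc x) = g (prefix (Suc x) \<pi>)"
      using assms(1)[of "Suc x"] unfolding SP_iff pf eq by blast
  qed
  then show ?thesis using that \<pi> by blast
qed

definition S :: "'q set" where "S = {\<pi> k | \<pi> k. \<pi> \<in> SP}"

lemma S_Pre1: "S \<subseteq> Pre1 H S"
proof
  fix s
  assume "s \<in> S"
  then obtain \<pi> k where \<pi>: "\<pi> \<in> SP" "s = \<pi> k" unfolding S_def by blast
  show "s \<in> Pre1 H S"
  proof (rule ccontr)
    assume "s \<notin> Pre1 H S"
    then obtain \<pi>' where "\<pi>' \<in> SP" "\<pi>' (Suc k) \<notin> S" using SP_deviate[OF \<pi>(1)] \<pi>(2) by metis
    then show False unfolding S_def by blast
  qed
qed

lemma S_states: "S \<subseteq> states H"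
  unfolding S_def strategy_plays_def using plays_states by blast

abbreviation G :: "nat \<Rightarrow> nat \<Rightarrow> 'q set \<Rightarrow> 'q set \<Rightarrow> 'q set" where
  "G a b T V \<equiv> lfp (Om H FA FG a b S T V)"

definition hit :: "nat \<Rightarrow> 'q set \<Rightarrow> (nat \<Rightarrow> 'q) \<Rightarrow> nat \<Rightarrow> nat set \<Rightarrow> bool" where
  "hit a T \<pi> k B \<longleftrightarrow> (\<exists>\<pi>'\<in>SP. \<exists>k'>k. (\<forall>x\<le>k. \<pi>' x = \<pi> x) \<and> \<pi>' k' \<notin> T \<and>
    (\<forall>b\<in>B. \<exists>j\<in>{k..<k'}. \<pi>' j \<in> FA b) \<and> (\<forall>j\<in>{k..k'}. \<pi>' j \<notin> FG a))"

lemma hit_cong: "(\<And>x. x \<le> k \<Longrightarrow> \<pi>' x = \<pi> x) \<Longrightarrow> hit a T \<pi>' k B = hit a T \<pi> k B"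
  unfolding hit_def by simp

lemma hit_earlier:
  assumes "hit a T \<pi> l B" "k \<le> l" "\<forall>j\<in>{k..l}. \<pi> j \<notin> FG a"
  shows "hit a T \<pi> k B"
proof -
  obtain \<pi>' k' where h: "\<pi>' \<in> SP" "k' > l" "\<forall>x\<le>l. \<pi>' x = \<pi> x" "\<pi>' k' \<notin> T"
    "\<forall>b\<in>B. \<exists>j\<in>{l..<k'}. \<pi>' j \<in> FA b" "\<forall>j\<in>{l..k'}. \<pi>' j \<notin> FG a"
    using assms(1) unfolding hit_def by blast
  have "\<forall>j\<in>{k..k'}. \<pi>' j \<notin> FG a"
  proof
    fix j
    assume "j \<in> {k..k'}"
    then show "\<pi>' j \<notin> FG a" using h(3,6) assms(3) by (cases "j \<le> l") auto
  qed
  moreover have "\<forall>b\<in>B. \<exists>j\<in>{k..<k'}. \<pi>' j \<in> FA b" using h(5) assms(2) by fastforce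
  ultimately show ?thesis unfolding hit_def using h assms(2) by (intro bexI[of _ \<pi>'] exI[of _ k']) auto
qed

text \<open>
  Fix \<open>b\<close>, and let \<open>V\<close> collect the end states of consistent histories \<open>(\<pi>, k)\<close> that are
  not \<open>hit\<close>. It is a post-fixpoint of \<open>G a b T\<close>: follow a continuation that is fair for
  the assumptions from a non-hit history ending outside \<open>L = G a b T V\<close>. Unfolding \<open>Om\<close>
  at a state outside \<open>L\<close>, either the state lies in \<open>FA b\<close> and \<open>T\<close> can be avoided next, or
  some deviation leads outside \<open>L \<union> (V - FA b)\<close>, or every successor is again outside \<open>L\<close>.
  The first two cases give a hit, and the third cannot persist, as \<open>FA b\<close> is visited.
\<close>

lemma hit_one:
  assumes T: "T = (\<Union>b\<in>{1..m}. gfp (G a b T))" and b: "b \<in> {1..m}"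
    and \<pi>: "\<pi> \<in> SP" "\<pi> k \<notin> gfp (G a b T)"
  shows "hit a T \<pi> k {b}"
proof -
  define V where "V = {\<pi> k | \<pi> k. \<pi> \<in> SP \<and> \<not> hit a T \<pi> k {b}}"
  define L where "L = G a b T V"
  have L: "L = Om H FA FG a b S T V L" unfolding L_def by (rule lfp_unfold[OF mono_Om])
  have notL: "s \<notin> FG a" "s \<notin> Pre1 H T"
    "s \<in> FA b \<or> s \<notin> PreE H L \<or> s \<notin> Pre1 H (L \<union> (V - FA b))"
    if "s \<in> S" "s \<notin> L" for s
  proof -
    have "s \<notin> Om H FA FG a b S T V L" using L that by blast
    then show "s \<notin> FG a" "s \<notin> Pre1 H T"
      "s \<in> FA b \<or> s \<notin> PreE H L \<or> s \<notin> Pre1 H (L \<union> (V - FA b))"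
      using that(1) S_Pre1 S_states unfolding Om_def CPre_def by blast+
  qed
  have SP_S: "\<pi> k \<in> S" if "\<pi> \<in> SP" for \<pi> k using that unfolding S_def by blast
  have T_FG: "s \<notin> FG a" if "s \<in> S" "s \<notin> T" for s
  proof -
    have "s \<notin> gfp (G a b T)" using T b that by blast
    moreover have "gfp (G a b T) = G a b T (gfp (G a b T))" by (rule gfp_unfold[OF mono_lfp_Om])
    moreover have "\<dots> = Om H FA FG a b S T (gfp (G a b T)) (G a b T (gfp (G a b T)))"
      by (rule lfp_unfold[OF mono_Om])
    ultimately have "s \<notin> Om H FA FG a b S T (gfp (G a b T)) (G a b T (gfp (G a b T)))" by simp
    then show ?thesis using that S_Pre1 unfolding Om_def by blast
  qed
  have hitA: "hit a T \<rho> l {b}" if \<rho>: "\<rho> \<in> SP" "\<rho> l \<notin> L" "\<rho> l \<in> FA b" for \<rho> l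
  proof -
    have "\<rho> l \<notin> Pre1 H T" using notL(2) \<rho> SP_S by blast
    then obtain \<rho>' where \<rho>': "\<rho>' \<in> SP" "\<And>x. x \<le> l \<Longrightarrow> \<rho>' x = \<rho> x" "\<rho>' (Suc l) \<notin> T"
      using SP_deviate[OF \<rho>(1)] by metis
    have "\<rho>' (Suc l) \<notin> FG a" using T_FG \<rho>'(1,3) SP_S by blast
    moreover have "\<rho>' l \<notin> FG a" using notL(1) \<rho>(1,2) \<rho>'(2) SP_S by simp
    ultimately have "\<rho>' j \<notin> FG a" if "j \<in> {l..Suc l}" for j
      using that by (auto simp: le_Suc_eq)
    then show ?thesis unfolding hit_def
      using \<rho>' \<rho>(3) by (intro bexI[of _ \<rho>'] exI[of _ "Suc l"]) auto
  qed
  have "V \<subseteq> L"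
  proof
    fix s
    assume "s \<in> V"
    then obtain \<rho>0 l where \<rho>0: "\<rho>0 \<in> SP" "\<not> hit a T \<rho>0 l {b}" "s = \<rho>0 l" unfolding V_def by blast
    obtain \<rho> where \<rho>: "\<rho> \<in> SP" "\<rho> \<in> buechi_plays H q m FA" "\<And>x. x \<le> l \<Longrightarrow> \<rho> x = \<rho>0 x"
      using SP_fair[OF \<rho>0(1)] by metis
    have nh: "\<not> hit a T \<rho> l {b}" using \<rho>0(2) hit_cong \<rho>(3) by metis
    show "s \<in> L"
    proof (rule ccontr)
      assume "s \<notin> L"
      then have l: "\<rho> l \<notin> L" using \<rho>0(3) \<rho>(3) by simp
      have stay: "\<forall>j\<in>{l..l + d}. \<rho> j \<notin> L" for d
      proof (induction d)
        case 0
        then show ?case using l by simp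
      next
        case (Suc d)
        let ?k = "l + d"
        have k: "\<rho> ?k \<notin> L" "\<rho> ?k \<in> S" using Suc SP_S \<rho>(1) by auto
        have nFG: "\<forall>j\<in>{l..?k}. \<rho> j \<notin> FG a" using Suc notL(1) SP_S \<rho>(1) by blast
        have nh': "\<not> hit a T \<rho>' ?k {b}" if "\<And>x. x \<le> ?k \<Longrightarrow> \<rho>' x = \<rho> x" for \<rho>'
          using nh hit_earlier[of a T \<rho> ?k "{b}" l] nFG hit_cong[of ?k \<rho>' \<rho>] that by auto
        have "\<rho> ?k \<notin> FA b" using hitA[OF \<rho>(1) k(1)] nh'[of \<rho>] by blast
        moreover have "\<rho> ?k \<in> Pre1 H (L \<union> (V - FA b))"
        proof (rule ccontr)
          assume "\<not> ?thesis"
          then obtain \<rho>' where \<rho>': "\<rho>' \<in> SP" "\<And>x. x \<le> ?k \<Longrightarrow> \<rho>' x = \<rho> x"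
            "\<rho>' (Suc ?k) \<notin> L \<union> (V - FA b)" using SP_deviate[OF \<rho>(1)] by metis
          have h: "hit a T \<rho>' (Suc ?k) {b}" using hitA \<rho>' unfolding V_def by blast
          have "\<rho>' (Suc ?k) \<notin> FG a" using notL(1) \<rho>'(1,3) SP_S by blast
          moreover have "\<rho>' ?k \<notin> FG a" using notL(1)[OF k(2,1)] \<rho>'(2)[of ?k] by simp
          ultimately have "\<forall>j\<in>{?k..Suc ?k}. \<rho>' j \<notin> FG a"
            by (metis atLeastAtMost_iff le_Suc_eq le_antisym)
          then have "hit a T \<rho>' ?k {b}" using hit_earlier[OF h, of ?k] by simp
          then show False using nh'[of \<rho>'] \<rho>'(2) by blast
        qed
        ultimately have "\<rho> ?k \<notin> PreE H L" using notL(3)[OF k(2,1)] by blast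
        moreover have "edge H (\<rho> ?k) (\<rho> (Suc ?k))" using \<rho>(1) unfolding SP_iff by blast
        ultimately have "\<rho> (Suc ?k) \<notin> L" unfolding PreE_def edge_def by blast
        then show ?case using Suc by (auto simp: le_Suc_eq)
      qed
      obtain k where k: "k \<ge> l" "\<rho> k \<in> FA b"
        using \<rho>(2) b unfolding buechi_plays_def INFM_nat_le by blast
      have kL: "\<forall>j\<in>{l..k}. \<rho> j \<notin> L" using stay[of "k - l"] k(1) by simp
      then have "hit a T \<rho> k {b}" using hitA[OF \<rho>(1) _ k(2)] k(1) by simp
      moreover have "\<forall>j\<in>{l..k}. \<rho> j \<notin> FG a" using kL notL(1) SP_S \<rho>(1) by blast
      ultimately show False using nh hit_earlier k(1) by blast
    qed
  qed
  then have "V \<subseteq> gfp (G a b T)" unfolding L_def by (rule gfp_upperbound)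
  then show ?thesis using \<pi> unfolding V_def by blast
qed

lemma hit_all:
  assumes T: "T = (\<Union>b\<in>{1..m}. gfp (G a b T))" and \<pi>: "\<pi> \<in> SP" "\<pi> k \<notin> T"
  shows "hit a T \<pi> k {1..m}"
proof -
  have "hit a T \<pi> k {1..Suc d}" if "Suc d \<le> m" for d
    using that
  proof (induction d)
    case 0
    then show ?case using hit_one[OF T _ \<pi>(1), of 1 k] T \<pi>(2) by auto
  next
    case (Suc d)
    then have "hit a T \<pi> k {1..Suc d}" by simp
    then obtain \<pi>' k' where h: "\<pi>' \<in> SP" "k' > k" "\<forall>x\<le>k. \<pi>' x = \<pi> x" "\<pi>' k' \<notin> T"
      "\<forall>b\<in>{1..Suc d}. \<exists>j\<in>{k..<k'}. \<pi>' j \<in> FA b" "\<forall>j\<in>{k..k'}. \<pi>' j \<notin> FG a"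
      unfolding hit_def by blast
    have b: "Suc (Suc d) \<in> {1..m}" using Suc.prems by simp
    then have "\<pi>' k' \<notin> gfp (G a (Suc (Suc d)) T)" using T h(4) by blast
    then have "hit a T \<pi>' k' {Suc (Suc d)}" by (rule hit_one[OF T b h(1)])
    then obtain \<rho> l where h': "\<rho> \<in> SP" "l > k'" "\<forall>x\<le>k'. \<rho> x = \<pi>' x" "\<rho> l \<notin> T"
      "\<exists>j\<in>{k'..<l}. \<rho> j \<in> FA (Suc (Suc d))" "\<forall>j\<in>{k'..l}. \<rho> j \<notin> FG a"
      unfolding hit_def by blast
    have "\<exists>j\<in>{k..<l}. \<rho> j \<in> FA b" if b: "b \<in> {1..Suc (Suc d)}" for b
    proof (cases "b = Suc (Suc d)")
      case True
      then show ?thesis using h'(5) h(2) by fastforce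
    next
      case False
      then have "b \<in> {1..Suc d}" using b by simp
      then obtain j where "j \<in> {k..<k'}" "\<pi>' j \<in> FA b" using h(5) by blast
      then show ?thesis using h'(2,3) by (intro bexI[of _ j]) auto
    qed
    moreover have "\<rho> j \<notin> FG a" if "j \<in> {k..l}" for j
      using that h(6) h'(3,6) by (cases "j \<le> k'") auto
    ultimately show ?case
      unfolding hit_def using h(2,3) h' by (intro bexI[of _ \<rho>] exI[of _ l]) auto
  qed
  from this[of "m - 1"] show ?thesis using m_pos by simp
qed

lemma S_subset_lfp:
  assumes a: "a \<in> {1..n}"
  shows "S \<subseteq> lfp (\<lambda>Y. \<Union>b\<in>{1..m}. gfp (G a b Y))"
proof (rule ccontr)
  define T where "T = lfp (\<lambda>Y. \<Union>b\<in>{1..m}. gfp (G a b Y))"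
  have T: "T = (\<Union>b\<in>{1..m}. gfp (G a b T))"
    unfolding T_def by (rule lfp_unfold[OF mono_gfp_Om])
  assume "\<not> ?thesis"
  then obtain \<pi>0 k0 where \<pi>0: "\<pi>0 \<in> SP" "\<pi>0 k0 \<notin> T" unfolding S_def T_def by blast
  define Q where "Q c c' \<longleftrightarrow> (case (c, c') of ((\<pi>, k), (\<pi>', k')) \<Rightarrow> k < k' \<and> (\<forall>x\<le>k. \<pi>' x = \<pi> x) \<and>
    (\<forall>b\<in>{1..m}. \<exists>j\<in>{k..<k'}. \<pi>' j \<in> FA b) \<and> (\<forall>j\<in>{k..k'}. \<pi>' j \<notin> FG a))" for c c' :: "(nat \<Rightarrow> 'q) \<times> nat"
  have "\<exists>c. \<forall>i::nat. (fst (c i) \<in> SP \<and> fst (c i) (snd (c i)) \<notin> T) \<and> Q (c i) (c (Suc i))"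
  proof (rule dependent_nat_choice)
    show "\<exists>x. fst x \<in> SP \<and> fst x (snd x) \<notin> T" using \<pi>0 by force
    fix x :: "(nat \<Rightarrow> 'q) \<times> nat"
    assume "fst x \<in> SP \<and> fst x (snd x) \<notin> T"
    then have "hit a T (fst x) (snd x) {1..m}" using hit_all[OF T] by blast
    then show "\<exists>y. (fst y \<in> SP \<and> fst y (snd y) \<notin> T) \<and> Q x y"
      unfolding hit_def Q_def by (cases x) force
  qed
  then obtain c where c: "\<And>i. fst (c i) \<in> SP" "\<And>i. Q (c i) (c (Suc i))" by blast
  define \<Pi> K where "\<Pi> i = fst (c i)" and "K i = snd (c i)" for i
  have cK: "c i = (\<Pi> i, K i)" for i unfolding \<Pi>_def K_def by simp
  have K: "K i < K (Suc i)" "\<And>x. x \<le> K i \<Longrightarrow> \<Pi> (Suc i) x = \<Pi> i x"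
    "\<And>b. b \<in> {1..m} \<Longrightarrow> \<exists>j\<in>{K i..<K (Suc i)}. \<Pi> (Suc i) j \<in> FA b"
    "\<And>j. j \<in> {K i..K (Suc i)} \<Longrightarrow> \<Pi> (Suc i) j \<notin> FG a" for i
    using c(2)[of i] unfolding Q_def cK by auto
  have "\<Pi> i \<in> SP" for i using c(1) unfolding \<Pi>_def by blast
  then obtain \<pi> where \<pi>: "\<pi> \<in> SP" "\<And>i x. x \<le> K i \<Longrightarrow> \<pi> x = \<Pi> i x"
    using SP_limit[of \<Pi> K] K by metis
  have Kge: "i \<le> K i" for i
    using K(1) by (simp add: strict_mono_Suc_iff strict_mono_imp_increasing)
  have "\<exists>k\<ge>i. \<pi> k \<in> FA b" if b: "b \<in> {1..m}" for i b
  proof -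
    obtain j where "j \<in> {K i..<K (Suc i)}" "\<Pi> (Suc i) j \<in> FA b" using K(3)[OF b] by blast
    then show ?thesis using \<pi>(2)[of j "Suc i"] Kge[of i] by (intro exI[of _ j]) auto
  qed
  moreover have p: "\<pi> \<in> plays H q" using \<pi>(1) unfolding strategy_plays_def by blast
  ultimately have "\<pi> \<in> buechi_plays H q m FA" unfolding buechi_plays_def INFM_nat_le by blast
  then have "\<pi> \<in> buechi_plays H q n FG" using winning \<pi>(1) unfolding compl_lang_def by blast
  then obtain k where k: "k \<ge> K 0" "\<pi> k \<in> FG a" using a unfolding buechi_plays_def INFM_nat_le by blast
  have "\<pi> j \<notin> FG a" if "K 0 \<le> j" "j \<le> K i" for i j
    using that
  proof (induction i)
    case 0
    then show ?case using K(4)[of j 0] K(1)[of 0] \<pi>(2)[of j 1] by auto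
  next
    case (Suc i)
    then show ?case using K(4)[of j i] \<pi>(2)[of j "Suc i"] by (cases "j \<le> K i") auto
  qed
  then show False using k Kge[of k] by blast
qed

lemma q_in_phi4: "q \<in> phi4 H m n FA FG"
proof -
  have "(\<lambda>a. if a \<in> {1..n} then S else {}) \<le> Zinf H m n FA FG"
    unfolding Zinf_def
  proof (rule gfp_upperbound, rule le_funI)
    fix a
    show "(if a \<in> {1..n} then S else {}) \<le> (if a \<in> {1..n}
       then lfp (\<lambda>Y. \<Union>b\<in>{1..m}. gfp (\<lambda>X. lfp (\<lambda>W. Om H FA FG a b
         (if nxt n a \<in> {1..n} then S else {}) Y X W)))
       else {})"
      using S_subset_lfp[of a] nxt_in_range[OF n_pos, of a] by simp
  qed
  from le_funD[OF this, of 1] have "S \<subseteq> Zinf H m n FA FG 1" using n_pos by simp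
  moreover have "q \<in> S"
  proof -
    obtain \<pi> where "\<pi> \<in> SP" using SP_complete[of "\<lambda>_. q" 0] by auto
    then show ?thesis unfolding S_def SP_iff by blast
  qed
  ultimately show ?thesis unfolding phi4_def using n_pos by auto
qed

end

theorem theorem3:
  fixes H :: "'q game" and m n :: nat
    and FA FG :: "nat \<Rightarrow> 'q set"
    and f :: "'q \<times> nat \<times> nat \<Rightarrow> 'q \<times> nat \<times> nat"
  assumes "game_graph H"
    and "\<And>q. q \<in> env H \<Longrightarrow> env_trans H q \<noteq> {}"
    and "1 \<le> m" and "1 \<le> n"
    and "\<And>b. b \<in> {1..m} \<Longrightarrow> FA b \<subseteq> states H"
    and "\<And>a. a \<in> {1..n} \<Longrightarrow> FG a \<subseteq> states H"
    and "mode_strategy H m n FA FG f"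
  shows "(\<forall>q \<in> phi4 H m n FA FG.
            mode_plays H m n FA FG q f
              \<subseteq> compl_lang H (buechi_plays H q m FA) \<union> buechi_plays H q n FG \<and>
            mode_plays H m n FA FG q f \<inter> buechi_plays H q n FG \<noteq> {} \<and>
            (buechi_plays H q n FG \<subseteq> buechi_plays H q m FA \<longrightarrow>
               pre (mode_plays H m n FA FG q f)
                 = pre (mode_plays H m n FA FG q f \<inter> buechi_plays H q m FA))) \<and>
         (\<forall>q \<in> states H - phi4 H m n FA FG. \<forall>g. system_strategy H g \<longrightarrow>
            \<not> ((strategy_plays H q g \<noteq> {} \<and>
                 strategy_plays H q g
                   \<subseteq> compl_lang H (buechi_plays H q m FA) \<union> buechi_plays H q n FG) \<and>
               pre (strategy_plays H q g)
                 = pre (strategy_plays H q g \<inter> buechi_plays H q m FA)))"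
proof -
  interpret gr1_game H m n FA FG
    using assms(1-4) by unfold_locales
  note f = assms(7)
  show ?thesis
  proof (intro conjI ballI allI impI)
    fix q
    assume q: "q \<in> phi4 H m n FA FG"
    show "mode_plays H m n FA FG q f
        \<subseteq> compl_lang H (buechi_plays H q m FA) \<union> buechi_plays H q n FG"
      using f by (rule mode_plays_sound)
    show "mode_plays H m n FA FG q f \<inter> buechi_plays H q n FG \<noteq> {}"
      using mode_plays_nonempty[OF f q] mode_play_extend[OF f] by (metis IntI all_not_in_conv)
    assume sub: "buechi_plays H q n FG \<subseteq> buechi_plays H q m FA"
    show "pre (mode_plays H m n FA FG q f)
        = pre (mode_plays H m n FA FG q f \<inter> buechi_plays H q m FA)"
    proof
      show "pre (mode_plays H m n FA FG q f)
          \<subseteq> pre (mode_plays H m n FA FG q f \<inter> buechi_plays H q m FA)"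
      proof
        fix w
        assume "w \<in> pre (mode_plays H m n FA FG q f)"
        then obtain k \<pi> where "\<pi> \<in> mode_plays H m n FA FG q f" "w = prefix k \<pi>"
          unfolding pre_def by blast
        then obtain \<pi>' where "\<pi>' \<in> mode_plays H m n FA FG q f" "\<pi>' \<in> buechi_plays H q n FG"
          "prefix k \<pi>' = w" using mode_play_extend[OF f] by metis
        then show "w \<in> pre (mode_plays H m n FA FG q f \<inter> buechi_plays H q m FA)"
          unfolding pre_def using sub by blast
      qed
    qed (auto simp: pre_def)
  next
    fix q g
    assume q: "q \<in> states H - phi4 H m n FA FG" and g: "system_strategy H g"
    show "\<not> ((strategy_plays H q g \<noteq> {} \<and>
          strategy_plays H q g
            \<subseteq> compl_lang H (buechi_plays H q m FA) \<union> buechi_plays H q n FG) \<and>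
        pre (strategy_plays H q g)
          = pre (strategy_plays H q g \<inter> buechi_plays H q m FA))"
    proof
      assume *: "(strategy_plays H q g \<noteq> {} \<and>
          strategy_plays H q g
            \<subseteq> compl_lang H (buechi_plays H q m FA) \<union> buechi_plays H q n FG) \<and>
        pre (strategy_plays H q g)
          = pre (strategy_plays H q g \<inter> buechi_plays H q m FA)"
      interpret system_winning H m n FA FG q g
        using q g * by unfold_locales blast+
      show False using q q_in_phi4 by blast
    qed
  qed
qed

end
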